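(* Let $K$ be a field and $n\ge1$. For any partition $\lambda=(\lambda_1,\dots,\lambda_n)\in\mathscr{P}_n$ and integers $0\le k\le n$, $s\ge0$, the following hold in the nilHecke algebra $\mathscr{H}_n^{(0)}$: $$b_\lambda b_{(1^k)}=\sum_{\mu\in\lambda\otimes1^k}b_\mu,\qquad b_\lambda b_{(s)}=\sum_{\mu\in\lambda\otimes s}b_\mu.$$
   Context: $\mathscr{H}_n^{(0)}$ is the unital associative $K$-algebra generated by $\psi_1,\dots,\psi_{n-1},y_1,\dots,y_n$ with relations: $\psi_r^2=0$; $\psi_r\psi_k=\psi_k\psi_r$ if $|r-k|>1$; $\psi_r\psi_{r+1}\psi_r=\psi_{r+1}\psi_r\psi_{r+1}$; $y_ry_k=y_ky_r$; $\psi_ry_{r+1}=y_r\psi_r+1$, $y_{r+1}\psi_r=\psi_ry_r+1$; $\psi_ry_k=y_k\psi_r$ if $k\ne r,r+1$. For $w\in\mathfrak{S}_n$ with reduced expression $w=s_{i_1}\cdots s_{i_k}$ ($s_i=(i,i+1)$), $\psi_w:=\psi_{i_1}\cdots\psi_{i_k}$ (independent of the reduced expression); $w_0$ is the longest element of $\mathfrak{S}_n$. $\mathscr{P}_n$ is the set of partitions $\lambda=(\lambda_1\ge\dots\ge\lambda_n\ge0)$ of length (number of nonzero parts) at most $n$. For $\lambda\in\mathscr{P}_n$, $$b_\lambda:=\psi_{w_0}y_1^{\lambda_1+n-1}y_2^{\lambda_2+n-2}\cdots y_n^{\lambda_n}\,\psi_{w_0}\,y_1^{n-1}y_2^{n-2}\cdots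 y_{n-1}.$$ For any partition $\mu$ of length $>n$, $b_\mu:=0$. $(1^k)$ is the partition with $k$ parts equal to $1$, and $(s)$ is the one-row partition. For a partition $\lambda$ and integer $k\geq 0$, $\lambda\otimes k$ (respectively $\lambda\otimes1^k$) is the set of all partitions obtained by adding $k$ boxes to the diagram of $\lambda$, at most one per column (respectively, at most one per row); for $k=0$ this set is $\{\lambda\}$. *)

theory Defs
  imports
    "HOL-Algebra.QuotRing"
    "HOL-Library.Poly_Mapping"
    "HOL-Combinatorics.Permutations"
begin

section \<open>The nilHecke algebra by generators and relations\<close>

datatype gen = Psi nat | Y nat

text \<open>The free monoid of words, written additively so that the convolution product of
  \<^theory>\<open>HOL-Library.Poly_Mapping\<close> becomes the product of the (noncommutative) free algebra.\<close>

datatype 'a word = Word (letters: "'a list")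

instantiation word :: (type) monoid_add
begin

definition zero_word :: "'a word" where "0 = Word []"

definition plus_word :: "'a word \<Rightarrow> 'a word \<Rightarrow> 'a word" where
  "u + v = Word (letters u @ letters v)"

instance
  by standard (simp_all add: zero_word_def plus_word_def)

end

text \<open>Generators are indexed from 1, as in \<open>\<psi>\<^sub>1, \<dots>, \<psi>\<^sub>n\<^sub>-\<^sub>1, y\<^sub>1, \<dots>, y\<^sub>n\<close>.\<close>

definition gens :: "nat \<Rightarrow> gen set" where
  "gens n = Psi ` {1..<n} \<union> Y ` {1..n}"

text \<open>The free unital associative \<open>K\<close>-algebra on \<open>gens n\<close>.  Scalars are embedded as \<open>single 0 c\<close>,
  so a two-sided ideal of this ring is automatically a \<open>K\<close>-subspace.\<close>

definition free_alg :: "nat \<Rightarrow> (gen word \<Rightarrow>\<^sub>0 'k::field) ring" where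
  "free_alg n =
    \<lparr>carrier = {f. \<forall>w \<in> Poly_Mapping.keys f. set (letters w) \<subseteq> gens n},
     monoid.mult = (*), one = 1, zero = 0, add = (+)\<rparr>"

definition var :: "gen \<Rightarrow> gen word \<Rightarrow>\<^sub>0 'k::field" where
  "var g = Poly_Mapping.single (Word [g]) 1"

text \<open>A relation \<open>a = b\<close> is represented by the element \<open>a - b\<close>.\<close>

definition nilHecke_rels :: "nat \<Rightarrow> (gen word \<Rightarrow>\<^sub>0 'k::field) set" where
  "nilHecke_rels n = (let \<psi> = \<lambda>r. var (Psi r); y = \<lambda>r. var (Y r) in
      {\<psi> r * \<psi> r | r. r \<in> {1..<n}}
    \<union> {\<psi> r * \<psi> k - \<psi> k * \<psi> r | r k. r \<in> {1..<n} \<and> k \<in> {1..<n} \<and> (r + 1 < k \<or> k + 1 < r)}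
    \<union> {\<psi> r * \<psi> (r + 1) * \<psi> r - \<psi> (r + 1) * \<psi> r * \<psi> (r + 1) | r. r \<in> {1..<n} \<and> r + 1 \<in> {1..<n}}
    \<union> {y r * y k - y k * y r | r k. r \<in> {1..n} \<and> k \<in> {1..n}}
    \<union> {\<psi> r * y (r + 1) - (y r * \<psi> r + 1) | r. r \<in> {1..<n}}
    \<union> {y (r + 1) * \<psi> r - (\<psi> r * y r + 1) | r. r \<in> {1..<n}}
    \<union> {\<psi> r * y k - y k * \<psi> r | r k. r \<in> {1..<n} \<and> k \<in> {1..n} \<and> k \<noteq> r \<and> k \<noteq> r + 1})"

type_synonym 'k nilHecke_elem = "(gen word \<Rightarrow>\<^sub>0 'k) set"

definition nilHecke :: "nat \<Rightarrow> 'k::field nilHecke_elem ring" where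
  "nilHecke n = free_alg n Quot (Idl\<^bsub>free_alg n\<^esub> (nilHecke_rels n))"

definition nh_gen :: "nat \<Rightarrow> gen \<Rightarrow> 'k::field nilHecke_elem" where
  "nh_gen n g = (Idl\<^bsub>free_alg n\<^esub> (nilHecke_rels n)) +>\<^bsub>free_alg n\<^esub> (var g)"

text \<open>The relators lie in the free algebra, so the quotient is a ring.\<close>

lemma free_alg_add:
  assumes "f \<in> carrier (free_alg n)" "g \<in> carrier (free_alg n)"
  shows "f + g \<in> carrier (free_alg n)"
  using assms keys_add[of f g] unfolding free_alg_def by auto

lemma free_alg_uminus: "f \<in> carrier (free_alg n) \<Longrightarrow> - f \<in> carrier (free_alg n)"
  by (simp add: free_alg_def)

lemma free_alg_diff:
  assumes "f \<in> carrier (free_alg n)" "g \<in> carrier (free_alg n)"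
  shows "f - g \<in> carrier (free_alg n)"
  using free_alg_add[OF assms(1) free_alg_uminus[OF assms(2)]] by simp

lemma free_alg_one: "1 \<in> carrier (free_alg n)"
  by (simp add: free_alg_def zero_word_def)

lemma free_alg_mult:
  assumes "f \<in> carrier (free_alg n)" "g \<in> carrier (free_alg n)"
  shows "f * g \<in> carrier (free_alg n)"
proof -
  have "set (letters w) \<subseteq> gens n" if "w \<in> Poly_Mapping.keys (f * g)" for w
  proof -
    obtain u v where "w = u + v" "u \<in> Poly_Mapping.keys f" "v \<in> Poly_Mapping.keys g"
      using keys_mult[of f g] \<open>w \<in> Poly_Mapping.keys (f * g)\<close> by blast
    moreover from this have "set (letters u) \<subseteq> gens n" "set (letters v) \<subseteq> gens n"
      using assms by (simp_all add: free_alg_def)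
    ultimately show ?thesis
      by (simp add: plus_word_def)
  qed
  then show ?thesis by (simp add: free_alg_def)
qed

lemma free_alg_ring: "ring (free_alg n :: (gen word \<Rightarrow>\<^sub>0 'k::field) ring)"
proof (rule ringI)
  let ?R = "free_alg n :: (gen word \<Rightarrow>\<^sub>0 'k) ring"
  show "abelian_group ?R"
  proof (rule abelian_groupI)
    fix x assume "x \<in> carrier ?R"
    then show "\<exists>y\<in>carrier ?R. y \<oplus>\<^bsub>?R\<^esub> x = \<zero>\<^bsub>?R\<^esub>"
      using free_alg_uminus[of x n] by (intro bexI[of _ "- x"]) (simp_all add: free_alg_def)
  next
    fix x y assume "x \<in> carrier ?R" "y \<in> carrier ?R"
    then show "x \<oplus>\<^bsub>?R\<^esub> y \<in> carrier ?R"
      using free_alg_add[of x n y] by (simp add: free_alg_def)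
  qed (simp_all add: free_alg_def add.assoc add.commute)
  show "Group.monoid ?R"
  proof (rule monoidI)
    fix x y assume "x \<in> carrier ?R" "y \<in> carrier ?R"
    then show "x \<otimes>\<^bsub>?R\<^esub> y \<in> carrier ?R"
      using free_alg_mult[of x n y] by (simp add: free_alg_def)
  next
    show "\<one>\<^bsub>?R\<^esub> \<in> carrier ?R"
      using free_alg_one[of n] by (simp add: free_alg_def)
  qed (simp_all add: free_alg_def mult.assoc)
qed (simp_all add: free_alg_def distrib_left distrib_right)

lemma var_in_free_alg: "g \<in> gens n \<Longrightarrow> var g \<in> carrier (free_alg n)"
  by (simp add: free_alg_def var_def)

lemma nilHecke_rels_in_free_alg:
  "nilHecke_rels n \<subseteq> carrier (free_alg n :: (gen word \<Rightarrow>\<^sub>0 'k::field) ring)"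
proof -
  have "(var (Psi r) :: gen word \<Rightarrow>\<^sub>0 'k) \<in> carrier (free_alg n)" if "r \<in> {1..<n}" for r
    using that by (intro var_in_free_alg) (simp add: gens_def)
  moreover have "(var (Y r) :: gen word \<Rightarrow>\<^sub>0 'k) \<in> carrier (free_alg n)" if "r \<in> {1..n}" for r
    using that by (intro var_in_free_alg) (simp add: gens_def)
  ultimately show ?thesis
    unfolding nilHecke_rels_def Let_def
    by (auto intro!: free_alg_add free_alg_diff free_alg_mult free_alg_one)
qed

lemma nilHecke_ring: "ring (nilHecke n :: 'k::field nilHecke_elem ring)"
  unfolding nilHecke_def
  by (intro ideal.quotient_is_ring ring.genideal_ideal free_alg_ring nilHecke_rels_in_free_alg)


section \<open>Symmetric group and the elements \<open>\<psi>\<^sub>w\<close>\<close>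

definition word_perm :: "nat list \<Rightarrow> nat \<Rightarrow> nat" where
  "word_perm ws = foldr (\<lambda>i w. Transposition.transpose i (i + 1) \<circ> w) ws id"

definition reduced_expr :: "nat \<Rightarrow> (nat \<Rightarrow> nat) \<Rightarrow> nat list \<Rightarrow> bool" where
  "reduced_expr n w ws \<longleftrightarrow> set ws \<subseteq> {1..<n} \<and> word_perm ws = w \<and>
    (\<forall>js. set js \<subseteq> {1..<n} \<and> word_perm js = w \<longrightarrow> length ws \<le> length js)"

definition perm_length :: "nat \<Rightarrow> (nat \<Rightarrow> nat) \<Rightarrow> nat" where
  "perm_length n w = (LEAST k. \<exists>ws. set ws \<subseteq> {1..<n} \<and> word_perm ws = w \<and> length ws = k)"

definition longest_perm :: "nat \<Rightarrow> nat \<Rightarrow> nat" where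
  "longest_perm n = (THE w. w permutes {1..n} \<and>
    (\<forall>v. v permutes {1..n} \<longrightarrow> perm_length n v \<le> perm_length n w))"

text \<open>By the braid relations the product does not depend on the chosen reduced expression.\<close>

definition psi_perm :: "nat \<Rightarrow> (nat \<Rightarrow> nat) \<Rightarrow> 'k::field nilHecke_elem" where
  "psi_perm n w = foldr (\<lambda>i x. nh_gen n (Psi i) \<otimes>\<^bsub>nilHecke n\<^esub> x)
    (SOME ws. reduced_expr n w ws) \<one>\<^bsub>nilHecke n\<^esub>"


section \<open>Partitions\<close>

text \<open>A partition is a function with \<open>p i\<close> its \<open>(i+1)\<close>-st part, padded by zeros.\<close>

definition is_partition :: "(nat \<Rightarrow> nat) \<Rightarrow> bool" where
  "is_partition p \<longleftrightarrow> antimono p \<and> finite {i. p i \<noteq> 0}"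

definition part_length :: "(nat \<Rightarrow> nat) \<Rightarrow> nat" where
  "part_length p = card {i. p i \<noteq> 0}"

definition partitions_upto :: "nat \<Rightarrow> (nat \<Rightarrow> nat) set" where
  "partitions_upto n = {p. is_partition p \<and> part_length p \<le> n}"

definition col_part :: "nat \<Rightarrow> nat \<Rightarrow> nat" where
  "col_part k = (\<lambda>i. if i < k then 1 else 0)"

definition row_part :: "nat \<Rightarrow> nat \<Rightarrow> nat" where
  "row_part s = (\<lambda>i. if i = 0 then s else 0)"

text \<open>Boxes are pairs (row, column), both counted from 0.\<close>

definition diagram :: "(nat \<Rightarrow> nat) \<Rightarrow> (nat \<times> nat) set" where
  "diagram p = {(i, j). j < p i}"

definition add_boxes :: "(nat \<Rightarrow> nat) \<Rightarrow> nat \<Rightarrow> (nat \<Rightarrow> nat) set" where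
  "add_boxes p k = {q. is_partition q \<and> diagram p \<subseteq> diagram q \<and> card (diagram q - diagram p) = k}"

definition add_horizontal :: "(nat \<Rightarrow> nat) \<Rightarrow> nat \<Rightarrow> (nat \<Rightarrow> nat) set" where
  "add_horizontal p k =
    {q \<in> add_boxes p k. \<forall>j. card {i. (i, j) \<in> diagram q - diagram p} \<le> 1}"

definition add_vertical :: "(nat \<Rightarrow> nat) \<Rightarrow> nat \<Rightarrow> (nat \<Rightarrow> nat) set" where
  "add_vertical p k =
    {q \<in> add_boxes p k. \<forall>i. card {j. (i, j) \<in> diagram q - diagram p} \<le> 1}"


section \<open>The elements \<open>b\<^sub>\<lambda>\<close>\<close>

text \<open>The monomial \<open>y\<^sub>1\<^bsup>e 1\<^esup> \<cdots> y\<^sub>n\<^bsup>e n\<^esup>\<close>.\<close>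

definition y_monom :: "nat \<Rightarrow> (nat \<Rightarrow> nat) \<Rightarrow> 'k::field nilHecke_elem" where
  "y_monom n e = foldr (\<lambda>i x. (nh_gen n (Y i) [^]\<^bsub>nilHecke n\<^esub> e i) \<otimes>\<^bsub>nilHecke n\<^esub> x)
    [1..<n + 1] \<one>\<^bsub>nilHecke n\<^esub>"

text \<open>\<open>p (i - 1)\<close> is the part \<open>\<lambda>\<^sub>i\<close>.\<close>

definition nh_b :: "nat \<Rightarrow> (nat \<Rightarrow> nat) \<Rightarrow> 'k::field nilHecke_elem" where
  "nh_b n p = (if part_length p \<le> n then
      psi_perm n (longest_perm n)
        \<otimes>\<^bsub>nilHecke n\<^esub> y_monom n (\<lambda>i. p (i - 1) + (n - i))
        \<otimes>\<^bsub>nilHecke n\<^esub> psi_perm n (longest_perm n)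
        \<otimes>\<^bsub>nilHecke n\<^esub> y_monom n (\<lambda>i. n - i)
    else \<zero>\<^bsub>nilHecke n\<^esub>)"

end

theory Submission
  imports Defs
begin

text \<open>
  Write \<open>P = \<psi>\<^sub>w\<^sub>0\<close> and \<open>D = y\<^sub>1\<^bsup>n-1\<^esup> \<cdots> y\<^sub>n\<^sub>-\<^sub>1\<close>, and put \<open>T(e) = P y\<^bsup>e\<^esup> P\<close> for an exponent vector \<open>e\<close>, so that
  \<open>b\<^sub>\<lambda> = T(\<lambda> + \<delta>) D\<close> with \<open>\<delta> = (n-1, \<dots>, 0)\<close>. The generator \<open>\<psi>\<^sub>r\<close> behaves like a divided difference operator: it
  commutes with every polynomial that is symmetric in \<open>y\<^sub>r, y\<^sub>r\<^sub>+\<^sub>1\<close>. Moreover \<open>P = a \<psi>\<^sub>r\<close> for some \<open>a\<close>, and \<open>\<psi>\<^sub>r P = 0\<close>.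
  Hence \<open>P f P = a f \<psi>\<^sub>r P = 0\<close> whenever \<open>f\<close> is symmetric in \<open>y\<^sub>r, y\<^sub>r\<^sub>+\<^sub>1\<close>. Taking \<open>f = y\<^bsup>e\<^esup> + y\<^bsup>s\<^sub>r e\<^esup>\<close>, and \<open>f = y\<^bsup>e\<^esup>\<close> when
  \<open>e = s\<^sub>r e\<close>, shows that \<open>T\<close> is alternating (lemmas \<open>sandwich_swap\<close> and \<open>sandwich_balanced\<close>). So \<open>T(\<lambda> + \<delta>)\<close> plays
  the role of a Schur polynomial given as a quotient of alternants, and Pieri's rule can be proved as it is for
  alternants.

  A symmetric sum \<open>c\<close> of monomials \<open>y\<^bsup>\<alpha>\<^esup>\<close> commutes with every \<open>\<psi>\<^sub>r\<close>, so \<open>c T(e)\<close> is the sum of the \<open>T(e + \<alpha>)\<close>. For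
  \<open>c = e\<^sub>k\<close> and \<open>e = \<lambda> + \<delta>\<close>, the terms that do not come from a partition have two equal adjacent exponents and vanish
  (\<open>column_pieri\<close>). For \<open>c = h\<^sub>s\<close>, the terms that do not come from a horizontal strip cancel under a sign-reversing
  exchange of adjacent exponents (\<open>row_pieri\<close>). With \<open>\<lambda> = \<emptyset>\<close> this reads \<open>T(\<mu> + \<delta>) = c T(\<delta>)\<close> for \<open>\<mu> = (1\<^sup>k)\<close> and
  \<open>\<mu> = (s)\<close>. Finally \<open>P D P = \<plusminus>P\<close>, so \<open>P D P D P = P\<close> (\<open>staircase_idempotent\<close>), and
  \<open>b\<^sub>\<lambda> b\<^sub>\<mu> = T(\<lambda> + \<delta>) D c P D P D = c P y\<^bsup>\<lambda>+\<delta>\<^esup> (P D P D P) D = c T(\<lambda> + \<delta>) D\<close>,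
  which is the required sum of the \<open>b\<^sub>\<nu> = T(\<nu> + \<delta>) D\<close>.

  The stated properties of \<open>P\<close> are read off words. Every word is braid equivalent to a normal word or to one containing
  a square. A single normal word has maximal length, namely the staircase word; so every reduced word of \<open>w\<^sub>0\<close>
  is equivalent to it (\<open>reduced_expr_longest\<close>), and it can be rewritten to begin or to end with any given letter.
\<close>

section \<open>Braid equivalence of words\<close>

text \<open>Words in the letters \<open>i\<close> stand for products of the generators \<open>\<psi>\<^sub>i\<close>, and equally for products of
  the transpositions \<open>s\<^sub>i\<close>. The congruence below is generated by the relations shared by both
  interpretations; they differ only in the value of a square, which is \<open>0\<close> in one and the identity
  in the other. What is proved about this congruence therefore transfers to both.\<close>

inductive braid_equiv :: "nat list \<Rightarrow> nat list \<Rightarrow> bool" (infix "\<approx>" 50) where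
  refl: "u \<approx> u"
| sym: "u \<approx> v \<Longrightarrow> v \<approx> u"
| trans: "u \<approx> v \<Longrightarrow> v \<approx> w \<Longrightarrow> u \<approx> w"
| append: "u \<approx> u' \<Longrightarrow> v \<approx> v' \<Longrightarrow> u @ v \<approx> u' @ v'"
| commute: "i + 1 < j \<or> j + 1 < i \<Longrightarrow> [i, j] \<approx> [j, i]"
| braid: "[i, i + 1, i] \<approx> [i + 1, i, i + 1]"

declare braid_equiv.refl [simp]

(* Splitting [j..<Suc m] at its right end would break up the cycles m ... j. *)
declare upt_Suc [simp del]
declare braid_equiv.trans [trans]

lemma braid_equiv_prefix: "v \<approx> v' \<Longrightarrow> u @ v \<approx> u @ v'"
  by (simp add: braid_equiv.append)

lemma braid_equiv_suffix: "u \<approx> u' \<Longrightarrow> u @ v \<approx> u' @ v"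
  by (simp add: braid_equiv.append)

lemma braid_equiv_context: "v \<approx> v' \<Longrightarrow> u @ v @ w \<approx> u @ v' @ w"
  by (simp add: braid_equiv.append)

lemma braid_equiv_set: "u \<approx> v \<Longrightarrow> set u = set v"
  by (induction rule: braid_equiv.induct) auto

lemma braid_equiv_length: "u \<approx> v \<Longrightarrow> length u = length v"
  by (induction rule: braid_equiv.induct) auto

lemma braid_equiv_rev: "u \<approx> v \<Longrightarrow> rev u \<approx> rev v"
proof (induction rule: braid_equiv.induct)
  case (braid i)
  then show ?case using braid_equiv.braid[of i] by simp
qed (auto intro: braid_equiv.intros)

lemma braid_equiv_move_past:
  assumes "\<And>x. x \<in> set u \<Longrightarrow> i + 1 < x \<or> x + 1 < i"
  shows "u @ [i] \<approx> [i] @ u"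
  using assms
proof (induction u)
  case (Cons a u)
  have "(a # u) @ [i] = [a] @ (u @ [i])" by simp
  also have "\<dots> \<approx> [a] @ ([i] @ u)"
    using Cons by (intro braid_equiv_prefix) auto
  also have "\<dots> = [a, i] @ u" by simp
  also have "\<dots> \<approx> [i, a] @ u"
    using Cons.prems[of a] by (intro braid_equiv_suffix braid_equiv.commute) auto
  finally show ?case by simp
qed simp

abbreviation descending :: "nat \<Rightarrow> nat \<Rightarrow> nat list" where
  "descending m j \<equiv> rev [j..<Suc m]"

text \<open>The cycle \<open>s\<^sub>m \<cdots> s\<^sub>j\<close> conjugates \<open>s\<^sub>k\<^sub>+\<^sub>1\<close> to \<open>s\<^sub>k\<close>. On words: the letter \<open>k + 1\<close> passes the letters below
  \<open>k\<close>, one braid move turns it into \<open>k\<close>, and this passes the letters above \<open>k + 1\<close>.\<close>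

lemma descending_move:
  assumes "j \<le> k" "k < m"
  shows "descending m j @ [Suc k] \<approx> [k] @ descending m j"
proof -
  have "[j..<Suc m] = [j..<k] @ [k..<Suc m]"
    using assms upt_add_eq_append[of j k "Suc m - k"] by simp
  also have "[k..<Suc m] = [k, Suc k] @ [Suc (Suc k)..<Suc m]"
    using assms by (simp add: upt_conv_Cons)
  finally have split: "descending m j = descending m (Suc (Suc k)) @ [Suc k, k] @ rev [j..<k]"
    by simp
  have "descending m j @ [Suc k] = (descending m (Suc (Suc k)) @ [Suc k, k]) @ (rev [j..<k] @ [Suc k])"
    unfolding split by simp
  also have "\<dots> \<approx> (descending m (Suc (Suc k)) @ [Suc k, k]) @ ([Suc k] @ rev [j..<k])"
    by (intro braid_equiv_prefix braid_equiv_move_past) auto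
  also have "\<dots> = descending m (Suc (Suc k)) @ [k + 1, k, k + 1] @ rev [j..<k]" by simp
  also have "\<dots> \<approx> descending m (Suc (Suc k)) @ [k, k + 1, k] @ rev [j..<k]"
    by (intro braid_equiv_context braid_equiv.sym[OF braid_equiv.braid])
  also have "\<dots> = (descending m (Suc (Suc k)) @ [k]) @ [Suc k, k] @ rev [j..<k]" by simp
  also have "\<dots> \<approx> ([k] @ descending m (Suc (Suc k))) @ [Suc k, k] @ rev [j..<k]"
    by (intro braid_equiv_suffix braid_equiv_move_past) auto
  also have "\<dots> = [k] @ descending m j" unfolding split by simp
  finally show ?thesis .
qed

text \<open>One normal word for every permutation: a permutation of \<open>{1..m + 1}\<close> is a permutation of
  \<open>{1..m}\<close> times one of the cycles \<open>s\<^sub>m \<cdots> s\<^sub>j\<close>, where \<open>j = m + 1\<close> gives the empty cycle.\<close>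

primrec normal_words :: "nat \<Rightarrow> nat list set" where
  "normal_words 0 = {[]}"
| "normal_words (Suc m) = {u @ descending m j |u j. u \<in> normal_words m \<and> 1 \<le> j \<and> j \<le> Suc m}"

text \<open>The normal word in which every cycle is as long as possible; it spells the longest permutation.\<close>

primrec stairs :: "nat \<Rightarrow> nat list" where
  "stairs 0 = []"
| "stairs (Suc m) = stairs m @ descending m 1"

lemma set_normal_word: "u \<in> normal_words m \<Longrightarrow> set u \<subseteq> {1..<m}"
proof (induction m arbitrary: u)
  case (Suc m)
  then obtain v j where v: "u = v @ descending m j" "v \<in> normal_words m" "1 \<le> j"
    by auto
  have "{j..<Suc m} \<subseteq> {1..<Suc m}" "{1..<m} \<subseteq> {1..<Suc m}" using v(3) by auto
  then show ?case using Suc.IH[OF v(2)] unfolding v(1) set_append set_rev set_upt by blast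
qed simp

lemma normal_words_SucI:
  "u \<in> normal_words m \<Longrightarrow> 1 \<le> j \<Longrightarrow> j \<le> Suc m \<Longrightarrow> u @ descending m j \<in> normal_words (Suc m)"
  by auto

lemma descending_Suc: "j \<le> Suc m \<Longrightarrow> descending (Suc m) j = Suc m # descending m j"
  by (simp add: upt_Suc)

lemma stairs_normal: "stairs m \<in> normal_words m"
proof (induction m)
  case (Suc m)
  then show ?case unfolding stairs.simps by (intro normal_words_SucI) simp_all
qed simp

lemma set_stairs: "set (stairs m) \<subseteq> {1..<m}"
  by (intro set_normal_word stairs_normal)

lemma normal_word_length:
  "u \<in> normal_words m \<Longrightarrow> length u \<le> length (stairs m) \<and> (length u = length (stairs m) \<longrightarrow> u = stairs m)"
proof (induction m arbitrary: u)
  case (Suc m)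
  then obtain v j where v: "u = v @ descending m j" "v \<in> normal_words m" "1 \<le> j" "j \<le> Suc m"
    by auto
  have IH: "length v \<le> length (stairs m)" "length v = length (stairs m) \<Longrightarrow> v = stairs m"
    using Suc.IH[OF v(2)] by auto
  have len: "length u = length v + (Suc m - j)" "length (stairs (Suc m)) = length (stairs m) + m"
    using v(1) by (simp_all)
  have "u = stairs (Suc m)" if "length u = length (stairs (Suc m))"
  proof -
    from that len IH(1) v(3) have "length v = length (stairs m)" "j = 1" using v(4) by linarith+
    then show ?thesis using IH(2) v(1) by simp
  qed
  with len IH(1) v(3) show ?case by auto
qed simp

text \<open>Such a word is \<open>0\<close> as a product of the \<open>\<psi>\<^sub>i\<close>, and as a product of transpositions it can be
  shortened by two letters.\<close>

definition has_square :: "nat list \<Rightarrow> bool" where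
  "has_square w \<longleftrightarrow> (\<exists>a b j. w \<approx> a @ [j, j] @ b)"

lemma has_square_equiv: "w \<approx> w' \<Longrightarrow> has_square w' \<Longrightarrow> has_square w"
  unfolding has_square_def by (meson braid_equiv.trans)

lemma has_square_append: assumes "has_square u" shows "has_square (u @ v)"
proof -
  obtain a b j where "u \<approx> a @ [j, j] @ b" using assms unfolding has_square_def by auto
  then have "u @ v \<approx> (a @ [j, j] @ b) @ v" by (rule braid_equiv_suffix)
  then have "u @ v \<approx> a @ [j, j] @ (b @ v)" by simp
  then show ?thesis unfolding has_square_def by blast
qed

text \<open>Appending one letter \<open>i\<close> to the last cycle \<open>m \<cdots> j\<close> either extends it (\<open>i = j - 1\<close>), creates a square
  (\<open>i = j\<close>), or moves a letter \<open>i\<close> or \<open>i - 1\<close> to the left of the cycle, where it is absorbed by the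
  shorter normal word.\<close>

lemma normal_word_snoc:
  assumes "u \<in> normal_words m" "1 \<le> i" "i < m"
  shows "(\<exists>v \<in> normal_words m. u @ [i] \<approx> v) \<or> has_square (u @ [i])"
  using assms
proof (induction m arbitrary: u i)
  case (Suc m)
  then obtain v j where v: "u = v @ descending m j" "v \<in> normal_words m" "1 \<le> j" "j \<le> Suc m"
    by auto
  have moved: ?case if i': "1 \<le> i'" "i' < m" and eq: "descending m j @ [i] \<approx> [i'] @ descending m j" for i'
  proof -
    have u: "u @ [i] \<approx> (v @ [i']) @ descending m j"
      using braid_equiv_prefix[OF eq, of v] v(1) by simp
    from Suc.IH[OF v(2) i'] show ?thesis
    proof
      assume "\<exists>w\<in>normal_words m. v @ [i'] \<approx> w"
      then obtain w where w: "w \<in> normal_words m" "v @ [i'] \<approx> w" by blast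
      then have "u @ [i] \<approx> w @ descending m j"
        using u braid_equiv_suffix braid_equiv.trans by blast
      moreover have "w @ descending m j \<in> normal_words (Suc m)" using w v by (intro normal_words_SucI)
      ultimately show ?thesis by blast
    next
      assume "has_square (v @ [i'])"
      then show ?thesis using u has_square_append has_square_equiv by blast
    qed
  qed
  consider "i + 1 = j" | "i = j" | "i + 1 < j" | "j < i" by linarith
  then show ?case
  proof cases
    case 1
    then have "u @ [i] = v @ descending m i" using v(4) by (simp add: v(1) upt_conv_Cons)
    moreover have "v @ descending m i \<in> normal_words (Suc m)" using v Suc.prems by (intro normal_words_SucI) simp_all
    ultimately show ?thesis by (metis braid_equiv.refl)
  next
    case 2
    then have "u @ [i] = (v @ descending m (Suc j)) @ [j, j] @ []"
      using Suc.prems by (simp add: v(1) upt_conv_Cons)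
    then show ?thesis unfolding has_square_def by (metis braid_equiv.refl)
  next
    case 3
    show ?thesis
      using braid_equiv_move_past[of "descending m j" i] 3 v Suc.prems by (intro moved[of i]) auto
  next
    case 4
    then show ?thesis
      using descending_move[of j "i - 1" m] v Suc.prems by (intro moved[of "i - 1"]) simp_all
  qed
qed simp

lemma word_normal_or_square:
  assumes "set w \<subseteq> {1..<m}"
  shows "(\<exists>v \<in> normal_words m. w \<approx> v) \<or> has_square w"
  using assms
proof (induction w rule: rev_induct)
  case Nil
  have "[] \<in> normal_words m"
  proof (induction m)
    case (Suc m)
    then show ?case using normal_words_SucI[of "[]" m "Suc m"] by simp
  qed simp
  then show ?case by (metis braid_equiv.refl)
next
  case (snoc i w)
  from snoc.prems have i: "1 \<le> i" "i < m" by auto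
  from snoc have "(\<exists>v \<in> normal_words m. w \<approx> v) \<or> has_square w" by auto
  then show ?case
  proof
    assume "\<exists>v\<in>normal_words m. w \<approx> v"
    then obtain v where v: "v \<in> normal_words m" "w @ [i] \<approx> v @ [i]"
      using braid_equiv_suffix by blast
    from normal_word_snoc[OF v(1) i] show ?thesis
      using v(2) braid_equiv.trans has_square_equiv by blast
  qed (use has_square_append in blast)
qed

text \<open>The mirror image of the recursion defining the staircase word. It shows that the word is equivalent to
  its reverse, so that facts about its last letter become facts about its first letter.\<close>

lemma stairs_Suc_left: "stairs (Suc m) \<approx> [1..<Suc m] @ stairs m"
proof (induction m)
  case (Suc m)
  have far: "stairs m @ [Suc m] \<approx> [Suc m] @ stairs m"
    by (rule braid_equiv_move_past) (use set_stairs[of m] in auto)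
  have "stairs (Suc (Suc m)) \<approx> ([1..<Suc m] @ stairs m) @ descending (Suc m) 1"
    using braid_equiv_suffix[OF Suc.IH] by (simp only: stairs.simps)
  also have "\<dots> = [1..<Suc m] @ (stairs m @ [Suc m]) @ descending m 1" by (simp add: descending_Suc)
  also have "\<dots> \<approx> [1..<Suc m] @ ([Suc m] @ stairs m) @ descending m 1"
    by (rule braid_equiv_context[OF far])
  also have "\<dots> = [1..<Suc (Suc m)] @ stairs (Suc m)" by (simp add: upt_Suc)
  finally show ?case .
qed simp

lemma stairs_rev: "rev (stairs m) \<approx> stairs m"
proof (induction m)
  case (Suc m)
  have "rev (stairs (Suc m)) = [1..<Suc m] @ rev (stairs m)" by simp
  also have "\<dots> \<approx> [1..<Suc m] @ stairs m" by (rule braid_equiv_prefix[OF Suc.IH])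
  also have "\<dots> \<approx> stairs (Suc m)" by (rule braid_equiv.sym[OF stairs_Suc_left])
  finally show ?case .
qed simp

text \<open>Every simple transposition is a right descent of the longest permutation.\<close>

lemma stairs_ends_with:
  assumes "1 \<le> i" "i < m"
  shows "\<exists>u. stairs m \<approx> u @ [i]"
  using assms
proof (induction m arbitrary: i)
  case (Suc m)
  show ?case
  proof (cases "i = 1")
    case True
    then have "stairs (Suc m) = (stairs m @ descending m 2) @ [i]"
      using Suc.prems by (simp add: upt_conv_Cons numeral_2_eq_2)
    then show ?thesis by (metis braid_equiv.refl)
  next
    case False
    then have move: "descending m 1 @ [i] \<approx> [i - 1] @ descending m 1"
      using descending_move[of 1 "i - 1" m] Suc.prems by simp
    from False obtain u where "stairs m \<approx> u @ [i - 1]" using Suc.IH[of "i - 1"] Suc.prems by fastforce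
    then have "stairs (Suc m) \<approx> (u @ [i - 1]) @ descending m 1"
      unfolding stairs.simps by (rule braid_equiv_suffix)
    also have "\<dots> = u @ ([i - 1] @ descending m 1)" by simp
    also have "\<dots> \<approx> u @ (descending m 1 @ [i])"
      by (rule braid_equiv_prefix[OF braid_equiv.sym[OF move]])
    finally show ?thesis by (metis append.assoc)
  qed
qed simp

lemma stairs_starts_with:
  assumes "1 \<le> i" "i < m"
  shows "\<exists>u. stairs m \<approx> [i] @ u"
proof -
  obtain u where "stairs m \<approx> u @ [i]" using stairs_ends_with[OF assms] by blast
  then have "rev (stairs m) \<approx> [i] @ rev u" using braid_equiv_rev by fastforce
  then show ?thesis using stairs_rev braid_equiv.sym braid_equiv.trans by blast
qed

section \<open>Normal words and the longest permutation\<close>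

lemma word_perm_Nil [simp]: "word_perm [] = id"
  by (simp add: word_perm_def)

lemma word_perm_Cons [simp]: "word_perm (i # w) = Transposition.transpose i (i + 1) \<circ> word_perm w"
  by (simp add: word_perm_def)

lemma word_perm_append [simp]: "word_perm (u @ v) = word_perm u \<circ> word_perm v"
  by (induction u) (simp_all add: o_assoc)

lemma braid_equiv_word_perm: "u \<approx> v \<Longrightarrow> word_perm u = word_perm v"
proof (induction rule: braid_equiv.induct)
  case (commute i j)
  then show ?case by (auto simp: fun_eq_iff Transposition.transpose_def)
next
  case (braid i)
  then show ?case by (auto simp: fun_eq_iff Transposition.transpose_def)
qed simp_all

lemma word_perm_permutes: "set w \<subseteq> {1..<n} \<Longrightarrow> word_perm w permutes {1..n}"
proof (induction w)
  case (Cons i w)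
  then show ?case
    unfolding word_perm_Cons by (intro permutes_compose permutes_swap_id) auto
qed simp

lemma square_not_shortest:
  assumes "has_square w" "set w \<subseteq> {1..<n}"
  shows "\<exists>v. set v \<subseteq> {1..<n} \<and> word_perm v = word_perm w \<and> length v < length w"
proof -
  obtain a b j where w: "w \<approx> a @ [j, j] @ b" using assms(1) unfolding has_square_def by auto
  have "word_perm (a @ b) = word_perm w"
    using braid_equiv_word_perm[OF w] by (simp add: fun_eq_iff)
  moreover have "length (a @ b) < length w" using braid_equiv_length[OF w] by simp
  moreover have "set (a @ b) \<subseteq> {1..<n}" using braid_equiv_set[OF w] assms(2) by auto
  ultimately show ?thesis by blast
qed

lemma word_perm_descending:
  assumes "j \<le> Suc m"
  shows "word_perm (descending m j) =
    (\<lambda>i. if i = j then Suc m else if j < i \<and> i \<le> Suc m then i - 1 else i)"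
proof (cases "j = Suc m")
  case True
  then show ?thesis by (auto simp: fun_eq_iff)
next
  case False
  with assms have "j \<le> m" by simp
  then show ?thesis
  proof (induction m rule: dec_induct)
    case base
    have "descending j j = [j]" by (simp add: upt_Suc)
    then show ?case by (auto simp: fun_eq_iff Transposition.transpose_def)
  next
    case (step m)
    have "descending (Suc m) j = Suc m # descending m j" using step by (simp add: descending_Suc)
    then show ?case using step by (auto simp: fun_eq_iff Transposition.transpose_def)
  qed
qed

lemma perm_eq_normal_word:
  assumes "v permutes {1..m}"
  shows "\<exists>u \<in> normal_words m. word_perm u = v"
  using assms
proof (induction m arbitrary: v)
  case (Suc m)
  \<comment> \<open>The last cycle must carry the preimage of the largest point to the top.\<close>
  define j where "j = inv_into UNIV v (Suc m)"
  have vj: "v j = Suc m" unfolding j_def using permutes_inverses(1)[OF Suc.prems] by simp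
  have j: "1 \<le> j" "j \<le> Suc m"
    using permutes_in_image[OF permutes_inv[OF Suc.prems], of "Suc m"] by (simp_all add: j_def)
  define c where "c = word_perm (descending m j)"
  have c: "c permutes {1..Suc m}"
    unfolding c_def by (rule word_perm_permutes) (use j in auto)
  have cj: "c j = Suc m" unfolding c_def using j by (simp add: word_perm_descending)
  let ?w = "v \<circ> inv_into UNIV c"
  have w: "?w permutes {1..Suc m}" by (intro permutes_compose permutes_inv c Suc.prems)
  have fix_top: "?w (Suc m) = Suc m"
    using cj vj permutes_inverses(2)[OF c, of j] by simp
  have "?w permutes {1..m}"
  proof (rule permutes_superset[OF w])
    fix x assume "x \<in> {1..Suc m} - {1..m}"
    then have "x = Suc m" by auto
    then show "?w x = x" using fix_top by blast
  qed
  then obtain u where u: "u \<in> normal_words m" "word_perm u = v \<circ> inv_into UNIV c" using Suc.IH[of ?w] by metis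
  have "word_perm (u @ descending m j) = v"
    using u permutes_inverses(2)[OF c] by (simp add: c_def fun_eq_iff)
  moreover have "u @ descending m j \<in> normal_words (Suc m)" using u j by (intro normal_words_SucI)
  ultimately show ?case by blast
qed simp

definition inversions :: "nat \<Rightarrow> (nat \<Rightarrow> nat) \<Rightarrow> (nat \<times> nat) set" where
  "inversions n w = {(a, b). 1 \<le> a \<and> a < b \<and> b \<le> n \<and> w b < w a}"

lemma finite_inversions: "finite (inversions n w)"
  by (rule finite_subset[of _ "{1..n} \<times> {1..n}"]) (auto simp: inversions_def)

text \<open>Multiplying by \<open>s\<^sub>i\<close> on the left exchanges the values \<open>i\<close> and \<open>i + 1\<close>, which affects the order of
  a single pair of positions.\<close>

lemma card_inversions_le: "card (inversions n (word_perm w)) \<le> length w"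
proof (induction w)
  case Nil
  have "inversions n (word_perm []) = {}" by (auto simp: inversions_def)
  then show ?case by (simp only: card.empty list.size)
next
  case (Cons i w)
  let ?v = "word_perm w"
  have "bij ?v"
  proof (induction w)
    case (Cons a w)
    then show ?case unfolding word_perm_Cons by (intro bij_comp bij_transpose)
  qed (simp only: word_perm_Nil bij_id)
  then have inj: "?v a = ?v b \<longleftrightarrow> a = b" for a b by (meson bij_is_inj injD)
  \<comment> \<open>The one pair of positions at which a new inversion can arise.\<close>
  define c where "c = (inv_into UNIV ?v i, inv_into UNIV ?v (i + 1))"
  have c: "?v (fst c) = i" "?v (snd c) = i + 1"
    using \<open>bij ?v\<close> by (simp_all add: c_def bij_is_surj surj_f_inv_f)
  have "inversions n (word_perm (i # w)) \<subseteq> insert c (inversions n ?v)"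
  proof
    fix x assume x: "x \<in> inversions n (word_perm (i # w))"
    obtain a b where ab: "x = (a, b)" by fastforce
    show "x \<in> insert c (inversions n ?v)"
    proof (cases "?v a = i \<and> ?v b = i + 1")
      case True
      then have "a = fst c" "b = snd c" using c inj by metis+
      then show ?thesis by (simp add: ab)
    next
      case False
      have "?v a \<noteq> ?v b" using x inj ab by (auto simp: inversions_def)
      then show ?thesis using x False ab by (auto simp: inversions_def Transposition.transpose_def split: if_splits)
    qed
  qed
  then have "card (inversions n (word_perm (i # w))) \<le> card (insert c (inversions n ?v))"
    by (intro card_mono) (simp_all add: finite_inversions)
  also have "\<dots> \<le> Suc (card (inversions n ?v))" by (rule card_insert_le_m1) simp_all
  finally show ?case using Cons.IH by (metis Suc_le_mono le_trans length_Cons)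
qed

lemma word_perm_stairs: "word_perm (stairs m) = (\<lambda>i. if 1 \<le> i \<and> i \<le> m then Suc m - i else i)"
proof (induction m)
  case (Suc m)
  then show ?case by (auto simp: fun_eq_iff word_perm_descending)
qed (simp add: fun_eq_iff)

lemma card_inversions_stairs: "card (inversions n (word_perm (stairs n))) = length (stairs n)"
proof -
  have "inversions n (word_perm (stairs n)) = {(a, b). 1 \<le> a \<and> a < b \<and> b \<le> n}"
    by (auto simp: inversions_def word_perm_stairs)
  moreover have "card {(a, b). 1 \<le> a \<and> a < b \<and> b \<le> m} = length (stairs m)" for m :: nat
  proof (induction m)
    case 0
    have "{(a, b). 1 \<le> a \<and> a < b \<and> b \<le> (0::nat)} = {}" by auto
    then show ?case by (simp only: card.empty stairs.simps list.size)
  next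
    case (Suc m)
    have "{(a, b). 1 \<le> a \<and> a < b \<and> b \<le> Suc m} =
        {(a, b). 1 \<le> a \<and> a < b \<and> b \<le> m} \<union> (\<lambda>a. (a, Suc m)) ` {1..m}"
      by (auto simp: le_Suc_eq)
    moreover have "finite {(a, b). 1 \<le> a \<and> a < b \<and> b \<le> m}"
      by (rule finite_subset[of _ "{1..m} \<times> {1..m}"]) auto
    moreover have "{(a, b). 1 \<le> a \<and> a < b \<and> b \<le> m} \<inter> (\<lambda>a. (a, Suc m)) ` {1..m} = {}" by auto
    ultimately have "card {(a, b). 1 \<le> a \<and> a < b \<and> b \<le> Suc m} =
        card {(a, b). 1 \<le> a \<and> a < b \<and> b \<le> m} + card ((\<lambda>a. (a, Suc m)) ` {1..m})"
      by (simp add: card_Un_disjoint)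
    also have "card ((\<lambda>a. (a, Suc m)) ` {1..m}) = m"
      by (subst card_image) (auto intro: inj_onI)
    finally show ?case using Suc.IH by simp
  qed
  ultimately show ?thesis by simp
qed

lemma stairs_shortest: "word_perm w = word_perm (stairs n) \<Longrightarrow> length (stairs n) \<le> length w"
  using card_inversions_le[of n w] card_inversions_stairs[of n] by simp

lemma perm_length_stairs: "perm_length n (word_perm (stairs n)) = length (stairs n)"
  unfolding perm_length_def
  by (rule Least_equality) (use set_stairs stairs_shortest in blast)+

text \<open>Every permutation has a normal word, no normal word is longer than the staircase and only the staircase
  has its length, and the inversion count shows that the staircase cannot be shortened. So its permutation
  is the unique one of maximal length.\<close>

lemma longest_perm_stairs: "longest_perm n = word_perm (stairs n)"
proof -
  have le: "perm_length n v \<le> length (stairs n) \<and>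
      (perm_length n v = length (stairs n) \<longrightarrow> v = word_perm (stairs n))"
    if v: "v permutes {1..n}" for v
  proof -
    obtain u where u: "u \<in> normal_words n" "word_perm u = v" using perm_eq_normal_word[OF v] by blast
    then have "perm_length n v \<le> length u"
      unfolding perm_length_def by (intro Least_le) (use set_normal_word in blast)
    then show ?thesis using normal_word_length[OF u(1)] u(2) by auto
  qed
  show ?thesis
    unfolding longest_perm_def
  proof (rule the_equality)
    show "word_perm (stairs n) permutes {1..n} \<and>
      (\<forall>v. v permutes {1..n} \<longrightarrow> perm_length n v \<le> perm_length n (word_perm (stairs n)))"
      using le word_perm_permutes[OF set_stairs] by (simp add: perm_length_stairs)
  next
    fix w assume w: "w permutes {1..n} \<and> (\<forall>v. v permutes {1..n} \<longrightarrow> perm_length n v \<le> perm_length n w)"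
    then have "length (stairs n) \<le> perm_length n w"
      using word_perm_permutes[OF set_stairs, of n] perm_length_stairs[of n] by metis
    then show "w = word_perm (stairs n)" using le w by (meson le_antisym)
  qed
qed

lemma reduced_expr_stairs: "reduced_expr n (longest_perm n) (stairs n)"
  unfolding reduced_expr_def longest_perm_stairs using set_stairs stairs_shortest by blast

text \<open>A reduced word contains no square up to equivalence, so it is equivalent to a normal word, and the length
  leaves only the staircase. This makes the choice of reduced word in \<open>\<psi>\<^sub>w\<^sub>0\<close> immaterial.\<close>

lemma reduced_expr_longest:
  assumes "reduced_expr n (longest_perm n) w"
  shows "w \<approx> stairs n"
proof -
  have w: "set w \<subseteq> {1..<n}" "word_perm w = word_perm (stairs n)"
    and min: "\<And>v. set v \<subseteq> {1..<n} \<Longrightarrow> word_perm v = word_perm w \<Longrightarrow> length w \<le> length v"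
    using assms unfolding reduced_expr_def longest_perm_stairs by auto
  have "\<not> has_square w" using square_not_shortest[OF _ w(1)] min by (meson not_le)
  then obtain v where v: "v \<in> normal_words n" "w \<approx> v" using word_normal_or_square[OF w(1)] by blast
  have "length (stairs n) \<le> length v" using stairs_shortest w(2) braid_equiv_word_perm[OF v(2)] by simp
  then have "v = stairs n" using normal_word_length[OF v(1)] by simp
  then show ?thesis using v(2) by simp
qed

section \<open>Divided difference relations in a ring\<close>

text \<open>Grouping a sum along an involution of the index set. It is used with \<open>C = {0}\<close> for a sign-reversing
  involution, and with \<open>C\<close> the commutant of an element for symmetrisation.\<close>

lemma (in abelian_monoid) finsum_involution_mem:
  assumes "finite A" "\<And>x. x \<in> A \<Longrightarrow> f x \<in> carrier G"
    and "\<And>x. x \<in> A \<Longrightarrow> \<sigma> x \<in> A" "\<And>x. x \<in> A \<Longrightarrow> \<sigma> (\<sigma> x) = x"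
    and zero: "\<zero> \<in> C" and add: "\<And>a b. a \<in> C \<Longrightarrow> b \<in> C \<Longrightarrow> a \<oplus> b \<in> C"
    and fixed: "\<And>x. x \<in> A \<Longrightarrow> \<sigma> x = x \<Longrightarrow> f x \<in> C"
    and pair: "\<And>x. x \<in> A \<Longrightarrow> \<sigma> x \<noteq> x \<Longrightarrow> f x \<oplus> f (\<sigma> x) \<in> C"
  shows "finsum G f A \<in> C"
  using assms(1-4) fixed pair
proof (induction A rule: finite_psubset_induct)
  case (psubset A)
  show ?case
  proof (cases "A = {}")
    case True
    then show ?thesis using zero by simp
  next
    case False
    then obtain x where x: "x \<in> A" by blast
    let ?B = "A - {x, \<sigma> x}"
    have closed: "f \<in> ?B \<rightarrow> carrier G" "f x \<in> carrier G" "f (\<sigma> x) \<in> carrier G"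
      using psubset.prems x by auto
    have B: "\<sigma> z \<in> ?B" if "z \<in> ?B" for z
      using that psubset.prems(2,3) x by (metis DiffE DiffI insert_iff singletonD)
    have IH: "finsum G f ?B \<in> C"
    proof (rule psubset.IH)
      show "?B \<subset> A" using x by blast
    qed (use psubset.prems B in auto)
    have fin: "finite ?B" using psubset.hyps by simp
    show ?thesis
    proof (cases "\<sigma> x = x")
      case True
      then have "A = insert x ?B" using x by blast
      then have "finsum G f A = f x \<oplus> finsum G f ?B"
        using finsum_insert[of ?B x f] fin closed True by simp
      then show ?thesis using add[OF _ IH] psubset.prems(4)[OF x True] by simp
    next
      case False
      have "A = insert x (insert (\<sigma> x) ?B)" using x psubset.prems(2)[OF x] by blast
      then have "finsum G f A = finsum G f (insert x (insert (\<sigma> x) ?B))" by simp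
      also have "\<dots> = f x \<oplus> (f (\<sigma> x) \<oplus> finsum G f ?B)"
        using fin closed False by (subst finsum_insert; (subst finsum_insert)?) auto
      also have "\<dots> = (f x \<oplus> f (\<sigma> x)) \<oplus> finsum G f ?B"
        using closed by (simp add: a_assoc)
      finally show ?thesis using add[OF _ IH] psubset.prems(5)[OF x False] by simp
    qed
  qed
qed

text \<open>Everything about the algebra follows from its relations alone, so the argument takes place in an
  arbitrary ring containing elements that satisfy them.\<close>

locale nilHecke_relations = ring R for R (structure) +
  fixes n :: nat and psi y :: "nat \<Rightarrow> 'a"
  assumes psi_closed [simp]: "r \<in> {1..<n} \<Longrightarrow> psi r \<in> carrier R"
    and y_closed [simp]: "r \<in> {1..n} \<Longrightarrow> y r \<in> carrier R"
    and psi_psi: "r \<in> {1..<n} \<Longrightarrow> psi r \<otimes> psi r = \<zero>"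
    and psi_comm: "r \<in> {1..<n} \<Longrightarrow> k \<in> {1..<n} \<Longrightarrow> r + 1 < k \<or> k + 1 < r \<Longrightarrow>
          psi r \<otimes> psi k = psi k \<otimes> psi r"
    and psi_braid: "r \<in> {1..<n} \<Longrightarrow> r + 1 \<in> {1..<n} \<Longrightarrow>
          psi r \<otimes> psi (r + 1) \<otimes> psi r = psi (r + 1) \<otimes> psi r \<otimes> psi (r + 1)"
    and y_comm: "r \<in> {1..n} \<Longrightarrow> k \<in> {1..n} \<Longrightarrow> y r \<otimes> y k = y k \<otimes> y r"
    and psi_y_Suc: "r \<in> {1..<n} \<Longrightarrow> psi r \<otimes> y (r + 1) = y r \<otimes> psi r \<oplus> \<one>"
    and y_Suc_psi: "r \<in> {1..<n} \<Longrightarrow> y (r + 1) \<otimes> psi r = psi r \<otimes> y r \<oplus> \<one>"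
    and psi_y_comm: "r \<in> {1..<n} \<Longrightarrow> k \<in> {1..n} \<Longrightarrow> k \<noteq> r \<Longrightarrow> k \<noteq> r + 1 \<Longrightarrow>
          psi r \<otimes> y k = y k \<otimes> psi r"
begin

definition psi_word :: "nat list \<Rightarrow> 'a" where
  "psi_word w = foldr (\<lambda>i x. psi i \<otimes> x) w \<one>"

lemma psi_word_Nil [simp]: "psi_word [] = \<one>"
  and psi_word_Cons [simp]: "psi_word (i # w) = psi i \<otimes> psi_word w"
  by (simp_all add: psi_word_def)

lemma psi_word_closed [simp]: "set w \<subseteq> {1..<n} \<Longrightarrow> psi_word w \<in> carrier R"
  by (induction w) auto

lemma psi_word_append:
  "set u \<subseteq> {1..<n} \<Longrightarrow> set v \<subseteq> {1..<n} \<Longrightarrow> psi_word (u @ v) = psi_word u \<otimes> psi_word v"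
  by (induction u) (auto simp: m_assoc)

lemma psi_word_braid_equiv:
  "u \<approx> v \<Longrightarrow> set u \<subseteq> {1..<n} \<Longrightarrow> psi_word u = psi_word v"
proof (induction rule: braid_equiv.induct)
  case (sym u v)
  then show ?case using braid_equiv_set by metis
next
  case (trans u v w)
  then show ?case using braid_equiv_set by metis
next
  case (append u u' v v')
  then have "set u' \<subseteq> {1..<n}" "set v' \<subseteq> {1..<n}"
    using braid_equiv_set[of u u'] braid_equiv_set[of v v'] by auto
  then show ?case using append by (simp add: psi_word_append)
next
  case (commute i j)
  then show ?case using psi_comm[of i j] by auto
next
  case (braid i)
  then show ?case using psi_braid[of i] by (auto simp: m_assoc)
qed simp

lemma psi_stairs_closed [simp]: "m \<le> n \<Longrightarrow> psi_word (stairs m) \<in> carrier R"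
  using set_stairs[of m] by (intro psi_word_closed) auto

text \<open>Divisibility by every \<open>\<psi>\<^sub>i\<close> on the right, together with annihilation by every \<open>\<psi>\<^sub>i\<close> on the left
  (\<open>psi_stairs_left_zero\<close>), is what makes \<open>\<psi>\<^sub>w\<^sub>0 y\<^bsup>e\<^esup> \<psi>\<^sub>w\<^sub>0\<close> alternating in \<open>e\<close>.\<close>

lemma psi_stairs_right_factor:
  assumes "m \<le> n" "1 \<le> i" "i < m"
  obtains a where "a \<in> carrier R" "psi_word (stairs m) = a \<otimes> psi i"
proof -
  obtain u where u: "stairs m \<approx> u @ [i]" using stairs_ends_with[OF assms(2,3)] by blast
  have m: "set (stairs m) \<subseteq> {1..<n}" using set_stairs[of m] assms(1) by auto
  then have "set u \<subseteq> {1..<n}" using braid_equiv_set[OF u] by auto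
  then show ?thesis
    using that[of "psi_word u"] psi_word_braid_equiv[OF u m] assms by (simp add: psi_word_append)
qed

lemma psi_stairs_left_zero:
  assumes "m \<le> n" "1 \<le> i" "i < m"
  shows "psi i \<otimes> psi_word (stairs m) = \<zero>"
proof -
  obtain u where u: "stairs m \<approx> [i] @ u" using stairs_starts_with[OF assms(2,3)] by blast
  have m: "set (stairs m) \<subseteq> {1..<n}" using set_stairs[of m] assms(1) by auto
  then have "set u \<subseteq> {1..<n}" using braid_equiv_set[OF u] by auto
  then have "psi i \<otimes> psi_word (stairs m) = (psi i \<otimes> psi i) \<otimes> psi_word u"
    using psi_word_braid_equiv[OF u m] assms by (simp add: m_assoc)
  also have "\<dots> = \<zero>" using \<open>set u \<subseteq> {1..<n}\<close> assms by (simp add: psi_psi)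
  finally show ?thesis .
qed

lemma pow_commute:
  assumes "a \<in> carrier R" "b \<in> carrier R" "a \<otimes> b = b \<otimes> a"
  shows "a \<otimes> (b [^] (k::nat)) = (b [^] k) \<otimes> a"
  using assms by (metis group_commutes_pow)

text \<open>A separate product over a list, so that facts about monomials can be proved by induction.\<close>

definition y_prod :: "nat list \<Rightarrow> (nat \<Rightarrow> nat) \<Rightarrow> 'a" where
  "y_prod l e = foldr (\<lambda>i x. (y i [^] e i) \<otimes> x) l \<one>"

lemma y_prod_closed [simp]: "set l \<subseteq> {1..n} \<Longrightarrow> y_prod l e \<in> carrier R"
  by (induction l) (auto simp: y_prod_def)

lemma y_prod_commute:
  assumes "a \<in> carrier R" "set l \<subseteq> {1..n}"
    and "\<And>i. i \<in> set l \<Longrightarrow> e i \<noteq> 0 \<Longrightarrow> a \<otimes> y i = y i \<otimes> a"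
  shows "a \<otimes> y_prod l e = y_prod l e \<otimes> a"
  using assms
proof (induction l)
  case (Cons i l)
  let ?p = "y i [^] e i" and ?q = "y_prod l e"
  have cl: "?p \<in> carrier R" "?q \<in> carrier R" using Cons.prems by auto
  have p: "a \<otimes> ?p = ?p \<otimes> a"
    using pow_commute[of a "y i" "e i"] Cons.prems by (cases "e i = 0") auto
  have q: "a \<otimes> ?q = ?q \<otimes> a" using Cons by auto
  have "a \<otimes> (?p \<otimes> ?q) = (a \<otimes> ?p) \<otimes> ?q" using cl Cons.prems by (simp add: m_assoc)
  also have "\<dots> = ?p \<otimes> (a \<otimes> ?q)" using cl Cons.prems by (simp add: p m_assoc)
  also have "\<dots> = (?p \<otimes> ?q) \<otimes> a" using cl Cons.prems by (simp add: q m_assoc)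
  finally show ?case by (simp add: y_prod_def)
qed (simp add: y_prod_def)

lemma y_prod_add:
  assumes "set l \<subseteq> {1..n}"
  shows "y_prod l (\<lambda>i. e i + f i) = y_prod l e \<otimes> y_prod l f"
  using assms
proof (induction l)
  case (Cons i l)
  let ?e = "y i [^] e i" and ?f = "y i [^] f i" and ?p = "y_prod l e" and ?q = "y_prod l f"
  have cl: "?e \<in> carrier R" "?f \<in> carrier R" "?p \<in> carrier R" "?q \<in> carrier R"
    using Cons.prems by auto
  have comm: "?f \<otimes> ?p = ?p \<otimes> ?f"
  proof (rule y_prod_commute)
    show "?f \<otimes> y k = y k \<otimes> ?f" if "k \<in> set l" for k
      using that Cons.prems pow_commute[of "y k" "y i" "f i"] y_comm[of k i] by auto
  qed (use Cons.prems cl in auto)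
  have "y_prod (i # l) (\<lambda>i. e i + f i) = (?e \<otimes> ?f) \<otimes> (?p \<otimes> ?q)"
    using Cons by (simp add: y_prod_def nat_pow_mult)
  also have "\<dots> = ?e \<otimes> (?f \<otimes> ?p) \<otimes> ?q" using cl by (simp add: m_assoc)
  also have "\<dots> = (?e \<otimes> ?p) \<otimes> (?f \<otimes> ?q)" using cl by (simp add: comm m_assoc)
  finally show ?case by (simp add: y_prod_def)
qed (simp add: y_prod_def)

definition y_mon :: "(nat \<Rightarrow> nat) \<Rightarrow> 'a" where
  "y_mon e = y_prod [1..<n + 1] e"

lemma y_mon_closed [simp]: "y_mon e \<in> carrier R"
  unfolding y_mon_def by (rule y_prod_closed) auto

lemma y_mon_add: "y_mon (\<lambda>i. e i + f i) = y_mon e \<otimes> y_mon f"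
  unfolding y_mon_def by (rule y_prod_add) auto

lemma y_mon_commute:
  assumes "a \<in> carrier R" "\<And>i. i \<in> {1..n} \<Longrightarrow> e i \<noteq> 0 \<Longrightarrow> a \<otimes> y i = y i \<otimes> a"
  shows "a \<otimes> y_mon e = y_mon e \<otimes> a"
  unfolding y_mon_def using assms by (intro y_prod_commute) auto

lemma y_mon_cong:
  assumes "\<And>i. i \<in> {1..n} \<Longrightarrow> e i = f i"
  shows "y_mon e = y_mon f"
  unfolding y_mon_def y_prod_def by (rule foldr_cong) (auto simp: assms)

lemma y_mon_zero: "y_mon (\<lambda>_. 0) = \<one>"
proof -
  have "foldr (\<lambda>i x. \<one> \<otimes> x) l \<one> = \<one>" for l :: "nat list" by (induction l) simp_all
  then show ?thesis by (simp add: y_mon_def y_prod_def)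
qed

lemma y_mon_single:
  assumes "i \<in> {1..n}"
  shows "y_mon (\<lambda>j. if j = i then d else 0) = y i [^] d"
proof -
  have ones: "y_prod l (\<lambda>j. if j = i then d else 0) = \<one>" if "i \<notin> set l" for l
    using that by (induction l) (auto simp: y_prod_def)
  have "y_prod l (\<lambda>j. if j = i then d else 0) = y i [^] d"
    if "distinct l" "i \<in> set l" "set l \<subseteq> {1..n}" for l
    using that
  proof (induction l)
    case (Cons a l)
    show ?case
    proof (cases "a = i")
      case True
      then have "y_prod l (\<lambda>j. if j = i then d else 0) = \<one>" using Cons.prems by (intro ones) auto
      then show ?thesis using True assms by (simp add: y_prod_def)
    next
      case False
      then have "y_prod l (\<lambda>j. if j = i then d else 0) = y i [^] d" using Cons by auto
      then show ?thesis using False assms by (simp add: y_prod_def)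
    qed
  qed simp
  from this[of "[1..<n + 1]"] show ?thesis
    using assms unfolding y_mon_def by (auto simp: atLeastLessThanSuc_atLeastAtMost)
qed

lemma y_mon_mult_commute: "y_mon e \<otimes> y_mon f = y_mon f \<otimes> y_mon e"
  by (simp add: y_mon_add[symmetric] add.commute)

definition commutant :: "'a \<Rightarrow> 'a set" where
  "commutant a = {x \<in> carrier R. a \<otimes> x = x \<otimes> a}"

lemma commutant_zero: "a \<in> carrier R \<Longrightarrow> \<zero> \<in> commutant a"
  by (simp add: commutant_def)

lemma commutant_add: "a \<in> carrier R \<Longrightarrow> x \<in> commutant a \<Longrightarrow> z \<in> commutant a \<Longrightarrow> x \<oplus> z \<in> commutant a"
  by (simp add: commutant_def l_distr r_distr)

lemma commutant_minus: "a \<in> carrier R \<Longrightarrow> x \<in> commutant a \<Longrightarrow> z \<in> commutant a \<Longrightarrow> x \<ominus> z \<in> commutant a"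
  by (simp add: commutant_def a_minus_def l_distr r_distr l_minus r_minus)

lemma commutant_mult:
  assumes "a \<in> carrier R" "x \<in> commutant a" "z \<in> commutant a"
  shows "x \<otimes> z \<in> commutant a"
proof -
  have c: "x \<in> carrier R" "z \<in> carrier R" "a \<otimes> x = x \<otimes> a" "a \<otimes> z = z \<otimes> a"
    using assms by (auto simp: commutant_def)
  have "a \<otimes> (x \<otimes> z) = (x \<otimes> a) \<otimes> z" using c assms(1) by (simp add: m_assoc[symmetric])
  also have "\<dots> = (x \<otimes> z) \<otimes> a" using c assms(1) by (simp add: m_assoc)
  finally show ?thesis using c by (simp add: commutant_def)
qed

lemma commutant_pow: "a \<in> carrier R \<Longrightarrow> x \<in> commutant a \<Longrightarrow> x [^] (k::nat) \<in> commutant a"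
  using pow_commute[of a x k] by (auto simp: commutant_def)

lemma y_sum_commutes:
  assumes "r \<in> {1..<n}"
  shows "y r \<oplus> y (r + 1) \<in> commutant (psi r)"
proof -
  have c: "psi r \<in> carrier R" "y r \<in> carrier R" "y (r + 1) \<in> carrier R" using assms by auto
  have "psi r \<otimes> (y r \<oplus> y (r + 1)) = psi r \<otimes> y r \<oplus> (y r \<otimes> psi r \<oplus> \<one>)"
    using c psi_y_Suc[OF assms] by (simp add: r_distr)
  also have "\<dots> = y r \<otimes> psi r \<oplus> (psi r \<otimes> y r \<oplus> \<one>)"
    using c by (simp add: a_ac)
  also have "\<dots> = (y r \<oplus> y (r + 1)) \<otimes> psi r"
    using c y_Suc_psi[OF assms] by (simp add: l_distr)
  finally show ?thesis using c by (simp add: commutant_def)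
qed

lemma y_prod_commutes:
  assumes "r \<in> {1..<n}"
  shows "y r \<otimes> y (r + 1) \<in> commutant (psi r)"
proof -
  have c: "psi r \<in> carrier R" "y r \<in> carrier R" "y (r + 1) \<in> carrier R" using assms by auto
  have "psi r \<otimes> (y r \<otimes> y (r + 1)) = (psi r \<otimes> y (r + 1)) \<otimes> y r"
    using c y_comm[of r "r + 1"] assms by (simp add: m_assoc)
  also have "\<dots> = y r \<otimes> (psi r \<otimes> y r \<oplus> \<one>)"
    using c by (simp add: psi_y_Suc[OF assms, simplified] l_distr r_distr m_assoc)
  also have "\<dots> = (y r \<otimes> y (r + 1)) \<otimes> psi r"
    using c by (simp add: y_Suc_psi[OF assms, simplified, symmetric] m_assoc)
  finally show ?thesis using c by (simp add: commutant_def)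
qed

text \<open>Power sums in two variables are generated by the elementary symmetric polynomials through
  \<open>p\<^sub>d\<^sub>+\<^sub>2 = p\<^sub>1 p\<^sub>d\<^sub>+\<^sub>1 - e\<^sub>2 p\<^sub>d\<close>.\<close>

lemma y_power_sum_commutes:
  assumes "r \<in> {1..<n}"
  shows "y r [^] (d::nat) \<oplus> y (r + 1) [^] d \<in> commutant (psi r)"
proof -
  let ?a = "y r" and ?b = "y (r + 1)"
  have c: "psi r \<in> carrier R" "?a \<in> carrier R" "?b \<in> carrier R" using assms by auto
  have comm: "?b \<otimes> ?a = ?a \<otimes> ?b" using y_comm[of r "r + 1"] assms by simp
  have "?a [^] d \<oplus> ?b [^] d \<in> commutant (psi r) \<and> ?a [^] Suc d \<oplus> ?b [^] Suc d \<in> commutant (psi r)"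
  proof (induction d)
    case 0
    have "\<one> \<in> commutant (psi r)" using c by (simp add: commutant_def)
    then show ?case using y_sum_commutes[OF assms] commutant_add[OF c(1)] c by simp
  next
    case (Suc d)
    let ?u = "?a [^] d" and ?v = "?b [^] d"
    have cu: "?u \<in> carrier R" "?v \<in> carrier R" using c by auto
    have ua: "?b \<otimes> ?u = ?u \<otimes> ?b" "?a \<otimes> ?v = ?v \<otimes> ?a" "?a \<otimes> ?u = ?u \<otimes> ?a" "?b \<otimes> ?v = ?v \<otimes> ?b"
      using pow_commute c comm by auto
    have "?a [^] Suc (Suc d) \<oplus> ?b [^] Suc (Suc d) =
        (?u \<otimes> ?a \<oplus> ?v \<otimes> ?b) \<otimes> (?a \<oplus> ?b) \<ominus> (?u \<oplus> ?v) \<otimes> (?a \<otimes> ?b)"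
    proof -
      have cancel: "(p \<oplus> q) \<oplus> (s \<oplus> t) \<ominus> (q \<oplus> s) = p \<oplus> t"
        if "p \<in> carrier R" "q \<in> carrier R" "s \<in> carrier R" "t \<in> carrier R" for p q s t
      proof -
        have "(p \<oplus> q) \<oplus> (s \<oplus> t) = (p \<oplus> t) \<oplus> (q \<oplus> s)" using that by (simp add: a_ac)
        then show ?thesis using that by (simp add: a_minus_def a_assoc r_neg)
      qed
      have "(?u \<otimes> ?a \<oplus> ?v \<otimes> ?b) \<otimes> (?a \<oplus> ?b) =
          (?u \<otimes> ?a \<otimes> ?a \<oplus> ?u \<otimes> (?a \<otimes> ?b)) \<oplus> (?v \<otimes> (?a \<otimes> ?b) \<oplus> ?v \<otimes> ?b \<otimes> ?b)"
        using c cu comm by (simp add: l_distr r_distr m_assoc a_ac)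
      moreover have "(?u \<oplus> ?v) \<otimes> (?a \<otimes> ?b) = ?u \<otimes> (?a \<otimes> ?b) \<oplus> ?v \<otimes> (?a \<otimes> ?b)"
        using c cu by (simp add: l_distr)
      ultimately show ?thesis using c cu by (simp add: cancel)
    qed
    also have "\<dots> \<in> commutant (psi r)"
      using Suc
      by (intro commutant_minus[OF c(1)] commutant_mult[OF c(1) _ y_sum_commutes[OF assms]]
            commutant_mult[OF c(1) _ y_prod_commutes[OF assms]]) simp_all
    finally show ?case using Suc by blast
  qed
  then show ?thesis ..
qed

text \<open>Here \<open>y\<^sub>r\<close> and \<open>y\<^sub>r\<^sub>+\<^sub>1\<close> occur only through a power of \<open>y\<^sub>r y\<^sub>r\<^sub>+\<^sub>1\<close>.\<close>

lemma y_mon_balanced_commutes: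
  assumes r: "r \<in> {1..<n}" and e: "e r = e (r + 1)"
  shows "y_mon e \<in> commutant (psi r)"
proof -
  let ?f = "e(r := 0, r + 1 := 0)"
  let ?s = "\<lambda>i. \<lambda>j. if j = i then e r else 0"
  have c: "psi r \<in> carrier R" "y r \<in> carrier R" "y (r + 1) \<in> carrier R" using r by auto
  have "y_mon e = y_mon (\<lambda>i. ?f i + (?s r i + ?s (r + 1) i))"
    using e by (intro y_mon_cong) auto
  also have "\<dots> = y_mon ?f \<otimes> (y r [^] e r \<otimes> y (r + 1) [^] e r)"
    unfolding y_mon_add using r by (simp add: y_mon_single del: fun_upd_apply)
  also have "y r [^] e r \<otimes> y (r + 1) [^] e r = (y r \<otimes> y (r + 1)) [^] e r"
    using c y_comm[of r "r + 1"] r by (intro pow_mult_distrib[symmetric]) auto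
  finally have "y_mon e = y_mon ?f \<otimes> (y r \<otimes> y (r + 1)) [^] e r" .
  moreover have "y_mon ?f \<in> commutant (psi r)"
    unfolding commutant_def using c psi_y_comm[OF r]
    by (auto intro!: y_mon_commute split: if_splits)
  ultimately show ?thesis
    using commutant_mult commutant_pow y_prod_commutes[OF r] c by simp
qed

text \<open>A balanced monomial times a power sum: \<open>y\<^sub>r\<^sup>a y\<^sub>r\<^sub>+\<^sub>1\<^sup>b + y\<^sub>r\<^sup>b y\<^sub>r\<^sub>+\<^sub>1\<^sup>a = (y\<^sub>r y\<^sub>r\<^sub>+\<^sub>1)\<^sup>m (y\<^sub>r\<^sup>d + y\<^sub>r\<^sub>+\<^sub>1\<^sup>d)\<close> with
  \<open>m = min a b\<close> and \<open>d = \<bar>a - b\<bar>\<close>.\<close>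

lemma y_mon_swap_commutes:
  assumes r: "r \<in> {1..<n}"
    and f: "f r = e (r + 1)" "f (r + 1) = e r" "\<And>i. i \<in> {1..n} \<Longrightarrow> i \<noteq> r \<Longrightarrow> i \<noteq> r + 1 \<Longrightarrow> f i = e i"
  shows "y_mon e \<oplus> y_mon f \<in> commutant (psi r)"
proof -
  define m where "m = min (e r) (e (r + 1))"
  define d where "d = max (e r) (e (r + 1)) - m"
  let ?g = "e(r := m, r + 1 := m)"
  let ?s = "\<lambda>i. \<lambda>j. if j = i then d else 0"
  have c: "psi r \<in> carrier R" "y r \<in> carrier R" "y (r + 1) \<in> carrier R" using r by auto
  have g: "y_mon ?g \<in> commutant (psi r)" using r by (intro y_mon_balanced_commutes) auto
  have shift: "y_mon (\<lambda>i. ?g i + ?s j i) = y_mon ?g \<otimes> y j [^] d" if "j = r \<or> j = r + 1" for j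
    unfolding y_mon_add using that r by (subst y_mon_single) auto
  have sum: "y_mon ?g \<otimes> (y r [^] d \<oplus> y (r + 1) [^] d) =
      y_mon (\<lambda>i. ?g i + ?s r i) \<oplus> y_mon (\<lambda>i. ?g i + ?s (r + 1) i)"
    using shift[of r] shift[of "r + 1"] c by (simp add: r_distr del: fun_upd_apply)
  have "y_mon e \<oplus> y_mon f = y_mon ?g \<otimes> (y r [^] d \<oplus> y (r + 1) [^] d)"
  proof (cases "e r \<le> e (r + 1)")
    case True
    have "y_mon e = y_mon (\<lambda>i. ?g i + ?s (r + 1) i)"
      using True f by (intro y_mon_cong) (auto simp: m_def d_def)
    moreover have "y_mon f = y_mon (\<lambda>i. ?g i + ?s r i)"
      using True f by (intro y_mon_cong) (auto simp: m_def d_def)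
    ultimately show ?thesis using sum a_comm y_mon_closed by metis
  next
    case False
    have "y_mon e = y_mon (\<lambda>i. ?g i + ?s r i)"
      using False f by (intro y_mon_cong) (auto simp: m_def d_def)
    moreover have "y_mon f = y_mon (\<lambda>i. ?g i + ?s (r + 1) i)"
      using False f by (intro y_mon_cong) (auto simp: m_def d_def)
    ultimately show ?thesis using sum by simp
  qed
  then show ?thesis
    using commutant_mult[OF c(1) g y_power_sum_commutes[OF r]] by simp
qed

text \<open>Up to the factor \<open>\<psi>\<^sub>w\<^sub>0\<close> this is the full antisymmetrisation of the monomial divided by the Vandermonde
  product.\<close>

definition sandwich :: "(nat \<Rightarrow> nat) \<Rightarrow> 'a" where
  "sandwich e = psi_word (stairs n) \<otimes> y_mon e \<otimes> psi_word (stairs n)"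

lemma sandwich_closed [simp]: "sandwich e \<in> carrier R"
  by (simp add: sandwich_def)

text \<open>Split off the last factor \<open>\<psi>\<^sub>r\<close> of the left copy of \<open>\<psi>\<^sub>w\<^sub>0\<close> and move it through \<open>z\<close>; it kills the right copy.\<close>

lemma sandwich_commutant:
  assumes r: "r \<in> {1..<n}" and z: "z \<in> commutant (psi r)"
  shows "psi_word (stairs n) \<otimes> z \<otimes> psi_word (stairs n) = \<zero>"
proof -
  let ?P = "psi_word (stairs n)"
  obtain a where a: "a \<in> carrier R" "?P = a \<otimes> psi r"
    using psi_stairs_right_factor[of n r] r by auto
  have c: "z \<in> carrier R" "psi r \<in> carrier R" "psi r \<otimes> z = z \<otimes> psi r"
    using z r by (auto simp: commutant_def)
  have "?P \<otimes> z \<otimes> ?P = (a \<otimes> psi r) \<otimes> z \<otimes> ?P" using a(2) by simp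
  also have "\<dots> = a \<otimes> (psi r \<otimes> z) \<otimes> ?P" using a(1) c by (simp add: m_assoc)
  also have "\<dots> = a \<otimes> z \<otimes> (psi r \<otimes> ?P)" using a(1) c by (simp add: m_assoc)
  also have "\<dots> = \<zero>" using a(1) c r psi_stairs_left_zero[of n r] by simp
  finally show ?thesis .
qed

lemma sandwich_balanced:
  assumes "r \<in> {1..<n}" "e r = e (r + 1)"
  shows "sandwich e = \<zero>"
  unfolding sandwich_def using assms sandwich_commutant y_mon_balanced_commutes by blast

lemma sandwich_swap:
  assumes "r \<in> {1..<n}"
    and "f r = e (r + 1)" "f (r + 1) = e r" "\<And>i. i \<in> {1..n} \<Longrightarrow> i \<noteq> r \<Longrightarrow> i \<noteq> r + 1 \<Longrightarrow> f i = e i"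
  shows "sandwich e \<oplus> sandwich f = \<zero>"
proof -
  have "sandwich e \<oplus> sandwich f = psi_word (stairs n) \<otimes> (y_mon e \<oplus> y_mon f) \<otimes> psi_word (stairs n)"
    by (simp add: sandwich_def l_distr r_distr)
  then show ?thesis using sandwich_commutant[OF assms(1) y_mon_swap_commutes[OF assms]] by simp
qed

lemma psi_word_commute:
  assumes "set w \<subseteq> {1..<n}" "z \<in> carrier R" "\<And>r. r \<in> set w \<Longrightarrow> z \<in> commutant (psi r)"
  shows "psi_word w \<otimes> z = z \<otimes> psi_word w"
  using assms
proof (induction w)
  case (Cons r w)
  have c: "psi r \<in> carrier R" "psi_word w \<in> carrier R" using Cons.prems by auto
  have "psi r \<otimes> psi_word w \<otimes> z = psi r \<otimes> (z \<otimes> psi_word w)"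
    using Cons c by (simp add: m_assoc)
  also have "\<dots> = z \<otimes> psi r \<otimes> psi_word w"
    using Cons.prems(3)[of r] Cons.prems c by (simp add: m_assoc[symmetric] commutant_def)
  also have "\<dots> = z \<otimes> psi_word (r # w)" using c Cons.prems by (simp add: m_assoc)
  finally show ?case by simp
qed simp

text \<open>Each \<open>\<psi>\<^sub>r\<close> passes \<open>y\<^sub>1 \<cdots> y\<^sub>r\<^sub>-\<^sub>1\<close> and meets \<open>y\<^sub>r\<close>, where \<open>\<psi>\<^sub>r y\<^sub>r = y\<^sub>r\<^sub>+\<^sub>1 \<psi>\<^sub>r - 1\<close>; the first term vanishes because
  \<open>\<psi>\<^sub>r\<close> annihilates the staircase product to its right. Each step contributes a
  sign.\<close>

lemma ascending_staircase:
  assumes "j \<le> m" "Suc m \<le> n"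
  shows "psi_word [1..<Suc j] \<otimes> y_mon (\<lambda>i. if i \<le> j then 1 else 0) \<otimes> psi_word (stairs (Suc m))
    \<in> {psi_word (stairs (Suc m)), \<ominus> psi_word (stairs (Suc m))}"
  using assms(1)
proof (induction j)
  case 0
  have "y_mon (\<lambda>i. if i \<le> 0 then 1 else 0) = \<one>"
    unfolding y_mon_zero[symmetric] by (rule y_mon_cong) auto
  then show ?case using psi_stairs_closed[OF assms(2)] by (simp del: stairs.simps)
next
  case (Suc j)
  let ?P = "psi_word (stairs (Suc m))" and ?r = "Suc j"
  let ?D = "psi_word [1..<Suc j]"
  let ?z = "y_mon (\<lambda>i. if i \<le> j then 1 else 0)"
  have r: "?r \<in> {1..<n}" using Suc.prems assms by auto
  have sub: "set [1..<Suc j] \<subseteq> {1..<n}" using r by auto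
  have c: "psi ?r \<in> carrier R" "y ?r \<in> carrier R" "y (?r + 1) \<in> carrier R" "?P \<in> carrier R" "?D \<in> carrier R"
    using r assms sub by (auto simp del: stairs.simps)
  have D: "psi_word [1..<Suc ?r] = ?D \<otimes> psi ?r"
    using psi_word_append[OF sub, of "[?r]"] r by (simp add: upt_Suc)
  have z: "y_mon (\<lambda>i. if i \<le> ?r then 1 else 0) = ?z \<otimes> y ?r"
  proof -
    have "y_mon (\<lambda>i. if i \<le> ?r then 1 else 0) =
      y_mon (\<lambda>i. (if i \<le> j then 1 else 0) + (if i = ?r then 1 else 0))"
      by (rule y_mon_cong) auto
    then show ?thesis unfolding y_mon_add using y_mon_single[of ?r 1] r c by simp
  qed
  have zc: "psi ?r \<otimes> ?z = ?z \<otimes> psi ?r"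
    using y_mon_balanced_commutes[of ?r "\<lambda>i. if i \<le> j then 1 else 0"] r by (auto simp: commutant_def)
  have "psi ?r \<otimes> y ?r = y (?r + 1) \<otimes> psi ?r \<ominus> \<one>"
    using y_Suc_psi[OF r] c by (simp add: a_minus_def a_assoc r_neg)
  then have "psi ?r \<otimes> y ?r \<otimes> ?P = y (?r + 1) \<otimes> (psi ?r \<otimes> ?P) \<ominus> ?P"
    using c by (simp add: a_minus_def l_distr l_minus m_assoc del: stairs.simps)
  also have "\<dots> = \<ominus> ?P"
    using psi_stairs_left_zero[of "Suc m" ?r] c assms Suc.prems by (simp add: a_minus_def del: stairs.simps)
  finally have key: "psi ?r \<otimes> y ?r \<otimes> ?P = \<ominus> ?P" .
  have "psi_word [1..<Suc ?r] \<otimes> y_mon (\<lambda>i. if i \<le> ?r then 1 else 0) \<otimes> ?P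
      = ?D \<otimes> (psi ?r \<otimes> ?z) \<otimes> y ?r \<otimes> ?P"
    unfolding D z using c by (simp add: m_assoc del: stairs.simps)
  also have "\<dots> = ?D \<otimes> ?z \<otimes> (psi ?r \<otimes> y ?r \<otimes> ?P)"
    unfolding zc using c by (simp add: m_assoc del: stairs.simps)
  also have "\<dots> = \<ominus> (?D \<otimes> ?z \<otimes> ?P)"
    unfolding key using c by (simp add: r_minus del: stairs.simps)
  finally show ?case using Suc.IH Suc.prems c by (auto simp del: stairs.simps)
qed

text \<open>Induction on \<open>m\<close>. Write the left copy as \<open>\<psi>\<^sub>1 \<cdots> \<psi>\<^sub>m\<close> times the smaller staircase product, the right copy
  as the smaller one times \<open>\<psi>\<^sub>m \<cdots> \<psi>\<^sub>1\<close>, and split the monomial for \<open>m + 1\<close> into the one for \<open>m\<close> and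
  \<open>y\<^sub>1 \<cdots> y\<^sub>m\<close>. The latter is symmetric in \<open>y\<^sub>1, \<dots>, y\<^sub>m\<close>, so it passes the smaller staircase product, and the
  induction hypothesis applies in the middle.\<close>

lemma staircase_sandwich:
  assumes "m \<le> n"
  shows "psi_word (stairs m) \<otimes> y_mon (\<lambda>i. m - i) \<otimes> psi_word (stairs m)
    \<in> {psi_word (stairs m), \<ominus> psi_word (stairs m)}"
  using assms
proof (induction m)
  case 0
  then show ?case by (simp add: y_mon_zero)
next
  case (Suc m)
  let ?P = "psi_word (stairs m)" and ?Q = "psi_word (stairs (Suc m))"
  let ?D = "psi_word [1..<Suc m]" and ?C = "psi_word (descending m 1)"
  let ?z = "y_mon (\<lambda>i. if i \<le> m then 1 else 0)" and ?d = "y_mon (\<lambda>i. m - i)"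
  have sub: "set (stairs m) \<subseteq> {1..<n}" "set [1..<Suc m] \<subseteq> {1..<n}" "set (descending m 1) \<subseteq> {1..<n}"
    "set (stairs (Suc m)) \<subseteq> {1..<n}"
    using set_stairs[of m] set_stairs[of "Suc m"] Suc.prems by auto
  have c: "?P \<in> carrier R" "?D \<in> carrier R" "?C \<in> carrier R" "?Q \<in> carrier R"
    using sub by (simp_all only: psi_word_closed)
  have QC: "?Q = ?P \<otimes> ?C" using psi_word_append[OF sub(1,3)] by simp
  have QD: "?Q = ?D \<otimes> ?P"
    using psi_word_braid_equiv[OF stairs_Suc_left[of m] sub(4)] psi_word_append[OF sub(2,1)] by simp
  have z: "?P \<otimes> ?z = ?z \<otimes> ?P"
  proof (rule psi_word_commute[OF sub(1)])
    fix r assume "r \<in> set (stairs m)"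
    then have "1 \<le> r" "r < m" using set_stairs[of m] by auto
    then show "?z \<in> commutant (psi r)"
      using Suc.prems by (intro y_mon_balanced_commutes) auto
  qed simp
  have mon: "y_mon (\<lambda>i. Suc m - i) = ?z \<otimes> ?d"
    unfolding y_mon_add[symmetric] by (rule y_mon_cong) auto
  have "?Q \<otimes> y_mon (\<lambda>i. Suc m - i) \<otimes> ?Q = (?D \<otimes> ?P) \<otimes> (?z \<otimes> ?d) \<otimes> (?P \<otimes> ?C)"
    unfolding mon using QC QD by simp
  also have "\<dots> = ?D \<otimes> (?P \<otimes> ?z) \<otimes> ?d \<otimes> ?P \<otimes> ?C"
    using c by (simp add: m_assoc)
  also have "\<dots> = ?D \<otimes> ?z \<otimes> (?P \<otimes> ?d \<otimes> ?P) \<otimes> ?C"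
    unfolding z using c by (simp add: m_assoc)
  finally have eq: "?Q \<otimes> y_mon (\<lambda>i. Suc m - i) \<otimes> ?Q = ?D \<otimes> ?z \<otimes> (?P \<otimes> ?d \<otimes> ?P) \<otimes> ?C" .
  have DzPC: "?D \<otimes> ?z \<otimes> ?P \<otimes> ?C = ?D \<otimes> ?z \<otimes> ?Q" unfolding QC using c by (simp add: m_assoc del: stairs.simps)
  from Suc.IH Suc.prems have "?P \<otimes> ?d \<otimes> ?P = ?P \<or> ?P \<otimes> ?d \<otimes> ?P = \<ominus> ?P" by simp
  then have "?Q \<otimes> y_mon (\<lambda>i. Suc m - i) \<otimes> ?Q \<in> {?D \<otimes> ?z \<otimes> ?Q, \<ominus> (?D \<otimes> ?z \<otimes> ?Q)}"
    unfolding eq DzPC[symmetric] using c by (elim disjE) (simp_all add: l_minus r_minus)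
  then show ?case
    using ascending_staircase[of m m] Suc.prems c by (auto simp del: stairs.simps)
qed

text \<open>Applying \<open>P D P = \<plusminus>P\<close> twice removes the sign.\<close>

lemma staircase_idempotent:
  defines "P \<equiv> psi_word (stairs n)" and "D \<equiv> y_mon (\<lambda>i. n - i)"
  shows "P \<otimes> D \<otimes> P \<otimes> D \<otimes> P = P"
proof -
  have c: "P \<in> carrier R" "D \<in> carrier R" by (simp_all add: P_def D_def)
  have "P \<otimes> D \<otimes> P = P \<or> P \<otimes> D \<otimes> P = \<ominus> P"
    using staircase_sandwich[of n] by (simp add: P_def D_def)
  then show ?thesis
  proof
    assume "P \<otimes> D \<otimes> P = \<ominus> P"
    moreover from this have "\<ominus> P \<otimes> D \<otimes> P = P" using c by (simp add: l_minus)
    ultimately show ?thesis by simp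
  qed simp
qed

end

section \<open>Strips as interlacing sequences\<close>

text \<open>A down-closed set of size \<open>c\<close> cannot contain \<open>x \<ge> c\<close>, as it would contain the \<open>x + 1\<close> numbers up to \<open>x\<close>.\<close>

lemma downset_eq_lessThan_card:
  fixes S :: "nat set"
  assumes "finite S" "\<And>i j. i \<le> j \<Longrightarrow> j \<in> S \<Longrightarrow> i \<in> S"
  shows "S = {..<card S}"
proof (rule card_subset_eq)
  show "S \<subseteq> {..<card S}"
  proof
    fix x assume "x \<in> S"
    then have "{..x} \<subseteq> S" using assms(2) by auto
    then have "card {..x} \<le> card S" using assms(1) card_mono by blast
    then show "x \<in> {..<card S}" by simp
  qed
qed simp_all

lemma partition_support:
  assumes "is_partition p"
  shows "{i. p i \<noteq> 0} = {..<part_length p}"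
  unfolding part_length_def
proof (rule downset_eq_lessThan_card)
  show "finite {i. p i \<noteq> 0}" using assms by (simp add: is_partition_def)
  show "i \<in> {i. p i \<noteq> 0}" if "i \<le> j" "j \<in> {i. p i \<noteq> 0}" for i j
    using assms that antimonoD[of p i j] by (auto simp: is_partition_def)
qed

lemma part_length_le_iff:
  assumes "is_partition p"
  shows "part_length p \<le> n \<longleftrightarrow> (\<forall>i\<ge>n. p i = 0)"
proof -
  have "p i = 0 \<longleftrightarrow> part_length p \<le> i" for i
    using partition_support[OF assms] by (metis (mono_tags, lifting) lessThan_iff mem_Collect_eq not_le)
  then show ?thesis by (meson le_refl order_trans)
qed

lemma antimono_SucI: "(\<And>i. q (Suc i) \<le> q i) \<Longrightarrow> antimono q" for q :: "nat \<Rightarrow> nat"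
  by (rule antimonoI, rule lift_Suc_antimono_le)

lemma support_subset:
  fixes q :: "nat \<Rightarrow> nat"
  assumes "\<And>i. n \<le> i \<Longrightarrow> q i = 0"
  shows "{i. q i \<noteq> 0} \<subseteq> {..<n}"
proof
  fix i assume "i \<in> {i. q i \<noteq> 0}"
  then show "i \<in> {..<n}" using assms[of i] by (cases "n \<le> i") auto
qed

lemma diagram_subset_iff: "diagram p \<subseteq> diagram q \<longleftrightarrow> (\<forall>i. p i \<le> q i)"
proof
  assume sub: "diagram p \<subseteq> diagram q"
  show "\<forall>i. p i \<le> q i"
  proof
    fix i
    show "p i \<le> q i"
    proof (cases "p i = 0")
      case False
      then have "(i, p i - 1) \<in> diagram p" by (simp add: diagram_def)
      then have "(i, p i - 1) \<in> diagram q" using sub by blast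
      then show ?thesis by (simp add: diagram_def)
    qed simp
  qed
qed (auto simp: diagram_def intro: less_le_trans)

lemma skew_row: "{j. (i, j) \<in> diagram q - diagram p} = {p i..<q i}"
  by (auto simp: diagram_def)

lemma card_skew:
  assumes "\<And>i. i \<ge> n \<Longrightarrow> q i = 0" "\<And>i. p i \<le> q i"
  shows "card (diagram q - diagram p) + sum p {..<n} = sum q {..<n}"
proof -
  have "i < n" if "j < q i" for i j
    using assms(1)[of i] that by (cases "n \<le> i") auto
  then have "diagram q - diagram p = Sigma {..<n} (\<lambda>i. {p i..<q i})"
    by (auto simp: diagram_def)
  then have "card (diagram q - diagram p) + sum p {..<n} = (\<Sum>i<n. (q i - p i) + p i)"
    by (simp add: sum.distrib)
  also have "\<dots> = sum q {..<n}" using assms(2) by simp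
  finally show ?thesis .
qed

text \<open>The sums in the theorem also range over partitions with more than \<open>n\<close> parts, so finiteness cannot be
  read off the description by sequences of length \<open>n\<close>. A partition arising by adding \<open>k\<close> boxes has at most
  \<open>k\<close> more rows, and each row grows by at most \<open>k\<close>.\<close>

lemma finite_add_boxes:
  assumes "is_partition p"
  shows "finite (add_boxes p k)"
proof -
  define m where "m = part_length p + k"
  have "add_boxes p k \<subseteq> {f. \<forall>x. (x \<in> {..<m} \<longrightarrow> f x \<in> {..p 0 + k}) \<and> (x \<notin> {..<m} \<longrightarrow> f x = 0)}"
  proof
    fix q assume q: "q \<in> add_boxes p k"
    then have part: "is_partition q" and le: "\<And>i. p i \<le> q i"
      and card: "card (diagram q - diagram p) = k"
      by (auto simp: add_boxes_def diagram_subset_iff)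
    have zero: "q i = 0" if "part_length q \<le> i" for i
      using part_length_le_iff[OF part, of "part_length q"] that by simp
    have nonzero: "i < part_length q" if "j < q i" for i j
      using zero[of i] that by (cases "part_length q \<le> i") auto
    have fin: "finite (diagram q - diagram p)"
      by (rule finite_subset[of _ "Sigma {..<part_length q} (\<lambda>i. {..<q i})"])
        (use nonzero in \<open>auto simp: diagram_def\<close>)
    \<comment> \<open>Every row of \<open>q\<close> below the rows of \<open>p\<close> contributes its first box.\<close>
    have "card ((\<lambda>i. (i, 0::nat)) ` {part_length p..<part_length q}) \<le> k"
      unfolding card[symmetric]
    proof (rule card_mono[OF fin])
      show "(\<lambda>i. (i, 0)) ` {part_length p..<part_length q} \<subseteq> diagram q - diagram p"
        using partition_support[OF part] partition_support[OF assms]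
        by (auto simp: diagram_def set_eq_iff)
    qed
    then have len: "part_length q \<le> m" by (simp add: card_image inj_on_def m_def)
    have bound: "q i \<le> p 0 + k" for i
    proof -
      have "card (Pair i ` {p i..<q i}) \<le> k"
        unfolding card[symmetric] by (rule card_mono[OF fin]) (auto simp: diagram_def)
      then have "q i - p i \<le> k" by (simp add: card_image inj_on_def)
      moreover have "p i \<le> p 0" using assms antimonoD[of p 0 i] by (simp add: is_partition_def)
      ultimately show ?thesis by linarith
    qed
    show "q \<in> {f. \<forall>x. (x \<in> {..<m} \<longrightarrow> f x \<in> {..p 0 + k}) \<and> (x \<notin> {..<m} \<longrightarrow> f x = 0)}"
      using bound zero len by auto
  qed
  then show ?thesis by (rule finite_subset) (intro finite_set_of_finite_funs finite_lessThan finite_atMost)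
qed

text \<open>Sequences of length \<open>n\<close> above \<open>p\<close>, not necessarily decreasing: multiplying by a symmetric polynomial
  produces such sequences, and those that are not partitions must then be eliminated.\<close>

definition extensions :: "nat \<Rightarrow> (nat \<Rightarrow> nat) \<Rightarrow> nat \<Rightarrow> (nat \<Rightarrow> nat) set" where
  "extensions n p s = {q. (\<forall>i\<ge>n. q i = 0) \<and> (\<forall>i. p i \<le> q i) \<and> sum q {..<n} = sum p {..<n} + s}"

lemma finite_extensions: "finite (extensions n p s)"
proof -
  have "extensions n p s \<subseteq> {f. \<forall>x. (x \<in> {..<n} \<longrightarrow> f x \<in> {..sum p {..<n} + s}) \<and> (x \<notin> {..<n} \<longrightarrow> f x = 0)}"
  proof
    fix q assume q: "q \<in> extensions n p s"
    have "q i \<le> sum q {..<n}" if "i < n" for i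
      using that by (intro member_le_sum) auto
    then show "q \<in> {f. \<forall>x. (x \<in> {..<n} \<longrightarrow> f x \<in> {..sum p {..<n} + s}) \<and> (x \<notin> {..<n} \<longrightarrow> f x = 0)}"
      using q by (auto simp: extensions_def)
  qed
  then show ?thesis by (rule finite_subset) (intro finite_set_of_finite_funs finite_lessThan finite_atMost)
qed

lemma add_boxes_extensions:
  assumes "p \<in> partitions_upto n"
  shows "{q \<in> add_boxes p s. part_length q \<le> n} = {q \<in> extensions n p s. antimono q}"
proof (rule Set.set_eqI)
  fix q :: "nat \<Rightarrow> nat"
  have "finite {i. q i \<noteq> 0}" if "\<forall>i\<ge>n. q i = 0"
    using support_subset[of n q] that finite_subset by blast
  then have "is_partition q \<and> part_length q \<le> n \<longleftrightarrow> antimono q \<and> (\<forall>i\<ge>n. q i = 0)"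
    unfolding is_partition_def using part_length_le_iff[of q n] is_partition_def by blast
  then show "q \<in> {q \<in> add_boxes p s. part_length q \<le> n} \<longleftrightarrow> q \<in> {q \<in> extensions n p s. antimono q}"
    using card_skew[of n q p] by (auto simp: add_boxes_def extensions_def diagram_subset_iff)
qed

definition vertical_extensions :: "nat \<Rightarrow> (nat \<Rightarrow> nat) \<Rightarrow> nat \<Rightarrow> (nat \<Rightarrow> nat) set" where
  "vertical_extensions n p k = {q \<in> extensions n p k. \<forall>i. q i \<le> p i + 1}"

lemma add_vertical_extensions:
  assumes "p \<in> partitions_upto n"
  shows "{q \<in> add_vertical p k. part_length q \<le> n} = {q \<in> vertical_extensions n p k. antimono q}"
proof -
  have "{q \<in> add_vertical p k. part_length q \<le> n} =
      {q \<in> {q \<in> add_boxes p k. part_length q \<le> n}. \<forall>i. q i \<le> p i + 1}"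
    unfolding add_vertical_def skew_row card_atLeastLessThan by (auto simp: le_diff_conv)
  then show ?thesis unfolding add_boxes_extensions[OF assms] vertical_extensions_def by auto
qed

text \<open>The interlacing condition makes \<open>q\<close> decreasing when \<open>p \<le> q\<close>.\<close>

definition horizontal_extensions :: "nat \<Rightarrow> (nat \<Rightarrow> nat) \<Rightarrow> nat \<Rightarrow> (nat \<Rightarrow> nat) set" where
  "horizontal_extensions n p s = {q \<in> extensions n p s. \<forall>i. q (Suc i) \<le> p i}"

text \<open>If \<open>q\<^sub>i\<^sub>+\<^sub>1 > p\<^sub>i\<close>, then column \<open>p\<^sub>i\<close> gains a box in both rows \<open>i\<close> and \<open>i + 1\<close>. Conversely, under interlacing the
  column intervals \<open>[p\<^sub>i, q\<^sub>i)\<close> of the new boxes are disjoint.\<close>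

lemma horizontal_strip_iff:
  assumes p: "antimono p" and q: "antimono q" "finite {i. q i \<noteq> 0}" and le: "\<And>i. p i \<le> q i"
  shows "(\<forall>j. card {i. (i, j) \<in> diagram q - diagram p} \<le> 1) \<longleftrightarrow> (\<forall>i. q (Suc i) \<le> p i)"
proof
  assume strip: "\<forall>j. card {i. (i, j) \<in> diagram q - diagram p} \<le> 1"
  show "\<forall>i. q (Suc i) \<le> p i"
  proof (rule ccontr)
    assume "\<not> (\<forall>i. q (Suc i) \<le> p i)"
    then obtain i where i: "p i < q (Suc i)" by (auto simp: not_le)
    have "q (Suc i) \<le> q i" "p (Suc i) \<le> p i" using antimonoD[OF q(1), of i "Suc i"] antimonoD[OF p, of i "Suc i"] by auto
    then have "{i, Suc i} \<subseteq> {l. (l, p i) \<in> diagram q - diagram p}"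
      using i by (auto simp: diagram_def)
    moreover have "finite {l. (l, p i) \<in> diagram q - diagram p}"
      by (rule finite_subset[OF _ q(2)]) (auto simp: diagram_def)
    ultimately have "card {i, Suc i} \<le> card {l. (l, p i) \<in> diagram q - diagram p}"
      by (intro card_mono)
    then show False using strip[rule_format, of "p i"] by simp
  qed
next
  assume inter: "\<forall>i. q (Suc i) \<le> p i"
  have "i = l" if "i \<le> l" "p i \<le> j" "j < q l" for i l j
  proof (rule ccontr)
    assume "i \<noteq> l"
    then have "q l \<le> q (Suc i)" using that(1) by (intro antimonoD[OF q(1)]) simp
    then show False using inter[rule_format, of i] that(2,3) by simp
  qed
  then have "i = l" if "p i \<le> j" "j < q i" "p l \<le> j" "j < q l" for i l j
    using that by (cases "i \<le> l") (blast, metis nat_le_linear)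
  then have eq: "i = l" if "(i, j) \<in> diagram q - diagram p" "(l, j) \<in> diagram q - diagram p" for i l j
    using that by (auto simp: diagram_def not_less)
  have "finite {i. (i, j) \<in> diagram q - diagram p}" for j
    by (rule finite_subset[OF _ q(2)]) (auto simp: diagram_def)
  then show "\<forall>j. card {i. (i, j) \<in> diagram q - diagram p} \<le> 1"
    using eq by (simp add: card_le_Suc0_iff_eq)
qed

lemma add_horizontal_extensions:
  assumes "p \<in> partitions_upto n"
  shows "{q \<in> add_horizontal p s. part_length q \<le> n} = horizontal_extensions n p s"
proof -
  have p: "antimono p" using assms by (simp add: partitions_upto_def is_partition_def)
  have "{q \<in> add_horizontal p s. part_length q \<le> n} =
      {q \<in> {q \<in> add_boxes p s. part_length q \<le> n}. \<forall>i. q (Suc i) \<le> p i}"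
    using horizontal_strip_iff[OF p]
    by (auto simp: add_horizontal_def add_boxes_def is_partition_def diagram_subset_iff)
  also have "\<dots> = {q \<in> {q \<in> extensions n p s. antimono q}. \<forall>i. q (Suc i) \<le> p i}"
    unfolding add_boxes_extensions[OF assms] ..
  also have "\<dots> = horizontal_extensions n p s"
  proof -
    have "antimono q" if "q \<in> extensions n p s" "\<forall>i. q (Suc i) \<le> p i" for q
      using that by (intro antimono_SucI) (auto simp: extensions_def intro: le_trans)
    then show ?thesis by (auto simp: horizontal_extensions_def)
  qed
  finally show ?thesis .
qed

lemma vertical_extensions_empty:
  assumes "k \<le> n"
  shows "{q \<in> vertical_extensions n (\<lambda>_. 0) k. antimono q} = {col_part k}"
proof (intro equalityI subsetI)
  fix q assume "q \<in> {q \<in> vertical_extensions n (\<lambda>_. 0) k. antimono q}"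
  then have q: "\<And>i. i \<ge> n \<Longrightarrow> q i = 0" "\<And>i. q i \<le> 1" "sum q {..<n} = k" "antimono q"
    by (auto simp: vertical_extensions_def extensions_def)
  have sub: "{i. q i \<noteq> 0} \<subseteq> {..<n}" using q(1) by (rule support_subset)
  then have fin: "finite {i. q i \<noteq> 0}" using finite_subset by blast
  have one: "q i = 1" if "q i \<noteq> 0" for i using q(2)[of i] that by simp
  have "k = sum q {i. q i \<noteq> 0}"
    unfolding q(3)[symmetric] using sub by (intro sum.mono_neutral_right) auto
  also have "\<dots> = (\<Sum>i | q i \<noteq> 0. 1)"
    by (intro sum.cong) (simp_all add: one)
  finally have k: "part_length q = k" by (simp add: part_length_def)
  have "{i. q i \<noteq> 0} = {..<k}"
    using partition_support[of q] q(4) fin k by (simp add: is_partition_def)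
  then have "q i = (if i < k then 1 else 0)" for i
    using one[of i] by (auto simp: set_eq_iff)
  then show "q \<in> {col_part k}" by (simp add: col_part_def fun_eq_iff)
next
  fix q assume "q \<in> {col_part k}"
  moreover have "(\<Sum>i<n. if i < k then 1 else 0) = k"
    using assms by (simp add: sum.If_cases Int_absorb1 lessThan_def[symmetric] flip: lessThan_subset_iff)
  ultimately show "q \<in> {q \<in> vertical_extensions n (\<lambda>_. 0) k. antimono q}"
    using assms by (auto simp: vertical_extensions_def extensions_def col_part_def monotone_def)
qed

lemma horizontal_extensions_empty:
  assumes "n \<ge> 1"
  shows "horizontal_extensions n (\<lambda>_. 0) s = {row_part s}"
proof -
  have sum: "sum q {..<n} = q 0" if "\<And>i. i \<noteq> 0 \<Longrightarrow> q i = 0" for q :: "nat \<Rightarrow> nat"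
    using sum.remove[of "{..<n}" 0 q] that assms by simp
  show ?thesis
  proof (intro equalityI subsetI)
    fix q assume "q \<in> horizontal_extensions n (\<lambda>_. 0) s"
    then have q: "\<And>i. q (Suc i) = 0" "sum q {..<n} = s"
      by (auto simp: horizontal_extensions_def extensions_def)
    have tail: "q i = 0" if "i \<noteq> 0" for i using q(1)[of "i - 1"] that by simp
    then have "q 0 = s" using sum[of q] q(2) by simp
    then show "q \<in> {row_part s}" using tail by (auto simp: row_part_def)
  next
    fix q assume "q \<in> {row_part s}"
    then show "q \<in> horizontal_extensions n (\<lambda>_. 0) s"
      using assms sum[of "row_part s"] by (auto simp: horizontal_extensions_def extensions_def row_part_def)
  qed
qed

lemma empty_partition: "(\<lambda>_. 0) \<in> partitions_upto n"
  by (simp add: partitions_upto_def is_partition_def part_length_def monotone_def)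

section \<open>Pieri rules\<close>

context nilHecke_relations
begin

text \<open>Weights are indexed from \<open>0\<close>, like the parts of a partition, while the variables \<open>y\<^sub>i\<close> are indexed from \<open>1\<close>.
  Invariance under adjacent exchanges makes the sum of the monomials a symmetric polynomial.\<close>

definition symmetric_weights :: "(nat \<Rightarrow> nat) set \<Rightarrow> bool" where
  "symmetric_weights X \<longleftrightarrow> finite X \<and> (\<forall>\<alpha>\<in>X. \<forall>r. Suc r < n \<longrightarrow> \<alpha> \<circ> Transposition.transpose r (Suc r) \<in> X)"

definition weight_sum :: "(nat \<Rightarrow> nat) set \<Rightarrow> 'a" where
  "weight_sum X = (\<Oplus>\<alpha>\<in>X. y_mon (\<lambda>i. \<alpha> (i - 1)))"

lemma weight_sum_closed [simp]: "weight_sum X \<in> carrier R"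
  by (simp add: weight_sum_def)

text \<open>Pair each weight with its image under the exchange: the sum of the two monomials commutes with \<open>\<psi>\<^sub>r\<close>,
  and so does the monomial of a weight that is its own image.\<close>

lemma weight_sum_commutant:
  assumes "symmetric_weights X" "r \<in> {1..<n}"
  shows "weight_sum X \<in> commutant (psi r)"
  unfolding weight_sum_def
proof (rule finsum_involution_mem[where \<sigma> = "\<lambda>\<alpha>. \<alpha> \<circ> Transposition.transpose (r - 1) r"])
  let ?t = "Transposition.transpose (r - 1) r"
  have psi: "psi r \<in> carrier R" using assms by simp
  show "finite X" using assms by (simp add: symmetric_weights_def)
  show "\<zero> \<in> commutant (psi r)" by (rule commutant_zero[OF psi])
  show "a \<oplus> b \<in> commutant (psi r)" if "a \<in> commutant (psi r)" "b \<in> commutant (psi r)" for a b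
    using commutant_add[OF psi that] .
  fix \<alpha> assume "\<alpha> \<in> X"
  show "\<alpha> \<circ> ?t \<in> X" using assms \<open>\<alpha> \<in> X\<close> unfolding symmetric_weights_def
    by (metis Suc_diff_1 Suc_le_eq atLeastLessThan_iff One_nat_def)
  show "(\<alpha> \<circ> ?t) \<circ> ?t = \<alpha>" by (simp add: o_assoc[symmetric])
  show "y_mon (\<lambda>i. \<alpha> (i - 1)) \<in> commutant (psi r)" if "\<alpha> \<circ> ?t = \<alpha>"
    using assms fun_cong[OF that, of r] by (intro y_mon_balanced_commutes) auto
  show "y_mon (\<lambda>i. \<alpha> (i - 1)) \<oplus> y_mon (\<lambda>i. (\<alpha> \<circ> ?t) (i - 1)) \<in> commutant (psi r)"
    using assms by (intro y_mon_swap_commutes) (auto simp: Transposition.transpose_def)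
qed simp

lemma weight_sum_y_mon: "finite X \<Longrightarrow> weight_sum X \<otimes> y_mon e = (\<Oplus>\<alpha>\<in>X. y_mon (\<lambda>i. e i + \<alpha> (i - 1)))"
  unfolding weight_sum_def by (subst finsum_ldistr) (auto simp: y_mon_add y_mon_mult_commute[of e] intro!: finsum_cong')

lemma weight_sum_commutes_y_mon: "finite X \<Longrightarrow> weight_sum X \<otimes> y_mon e = y_mon e \<otimes> weight_sum X"
  unfolding weight_sum_def
  by (subst finsum_ldistr, (auto)[3], subst finsum_rdistr)
    (auto simp: y_mon_mult_commute[of e] intro!: finsum_cong')

lemma weight_sum_commutes_staircase:
  assumes "symmetric_weights X"
  shows "psi_word (stairs n) \<otimes> weight_sum X = weight_sum X \<otimes> psi_word (stairs n)"
  using set_stairs[of n] weight_sum_commutant[OF assms] by (intro psi_word_commute) auto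

lemma weight_sum_sandwich:
  assumes "symmetric_weights X"
  shows "weight_sum X \<otimes> sandwich e = (\<Oplus>\<alpha>\<in>X. sandwich (\<lambda>i. e i + \<alpha> (i - 1)))"
proof -
  let ?P = "psi_word (stairs n)"
  have fin: "finite X" using assms by (simp add: symmetric_weights_def)
  have "weight_sum X \<otimes> sandwich e = (weight_sum X \<otimes> ?P) \<otimes> y_mon e \<otimes> ?P"
    by (simp add: sandwich_def m_assoc)
  also have "\<dots> = ?P \<otimes> (weight_sum X \<otimes> y_mon e) \<otimes> ?P"
    by (simp add: weight_sum_commutes_staircase[OF assms, symmetric] m_assoc)
  also have "\<dots> = (\<Oplus>\<alpha>\<in>X. ?P \<otimes> y_mon (\<lambda>i. e i + \<alpha> (i - 1)) \<otimes> ?P)"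
    unfolding weight_sum_y_mon[OF fin] using fin
    by (simp add: finsum_rdistr finsum_ldistr Pi_def)
  finally show ?thesis by (simp add: sandwich_def)
qed

text \<open>In the polynomial representation this is \<open>\<plusminus>s\<^sub>q \<psi>\<^sub>w\<^sub>0\<close> for a partition \<open>q\<close>, with \<open>s\<^sub>q\<close> the Schur polynomial.
  Sequences \<open>q\<close> that are not partitions are allowed, and straightened by the next lemmas.\<close>

definition schur :: "(nat \<Rightarrow> nat) \<Rightarrow> 'a" where
  "schur q = sandwich (\<lambda>i. q (i - 1) + (n - i))"

lemma schur_closed [simp]: "schur q \<in> carrier R"
  by (simp add: schur_def)

lemma weight_sum_schur:
  assumes "symmetric_weights X"
  shows "weight_sum X \<otimes> schur p = (\<Oplus>q\<in>(\<lambda>\<alpha> i. p i + \<alpha> i) ` X. schur q)"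
proof -
  have inj: "inj_on (\<lambda>\<alpha> i. p i + \<alpha> i) X" by (auto simp: inj_on_def fun_eq_iff)
  have "weight_sum X \<otimes> schur p = (\<Oplus>\<alpha>\<in>X. schur (\<lambda>i. p i + \<alpha> i))"
    unfolding schur_def weight_sum_sandwich[OF assms] by (intro finsum_cong') (auto simp: ac_simps)
  also have "\<dots> = (\<Oplus>q\<in>(\<lambda>\<alpha> i. p i + \<alpha> i) ` X. schur q)"
    by (rule finsum_reindex[symmetric, OF _ inj]) simp
  finally show ?thesis .
qed

text \<open>Exchanging adjacent exponents, in terms of the parts: the shift by \<open>n - i\<close> turns the exchange into the
  dot action \<open>(a, b) \<mapsto> (b - 1, a + 1)\<close>.\<close>

lemma schur_swap:
  assumes "Suc j < n" "q (Suc j) \<noteq> 0"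
  shows "schur q \<oplus> schur (q(j := q (Suc j) - 1, Suc j := q j + 1)) = \<zero>"
  unfolding schur_def by (rule sandwich_swap[of "Suc j"]) (use assms in auto)

lemma schur_zero:
  assumes "Suc j < n" "q (Suc j) = q j + 1"
  shows "schur q = \<zero>"
  unfolding schur_def by (rule sandwich_balanced[of "Suc j"]) (use assms in auto)

text \<open>The exponents of the elementary symmetric polynomial \<open>e\<^sub>k\<close>.\<close>

definition column_weights :: "nat \<Rightarrow> (nat \<Rightarrow> nat) set" where
  "column_weights k = vertical_extensions n (\<lambda>_. 0) k"

text \<open>The exponents of the complete homogeneous symmetric polynomial \<open>h\<^sub>s\<close>.\<close>

definition row_weights :: "nat \<Rightarrow> (nat \<Rightarrow> nat) set" where
  "row_weights s = extensions n (\<lambda>_. 0) s"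

lemma extensions_transpose:
  assumes "\<alpha> \<in> extensions n (\<lambda>_. 0) s" "Suc r < n"
  shows "\<alpha> \<circ> Transposition.transpose r (Suc r) \<in> extensions n (\<lambda>_. 0) s"
proof -
  let ?t = "Transposition.transpose r (Suc r)"
  have "?t permutes {..<n}" using assms(2) by (intro permutes_swap_id) auto
  then have "sum \<alpha> {..<n} = sum (\<alpha> \<circ> ?t) {..<n}" by (rule sum.permute)
  moreover have "\<alpha> (?t i) = 0" if "i \<ge> n" for i
    using assms that by (auto simp: extensions_def Transposition.transpose_def)
  ultimately show ?thesis using assms(1) by (auto simp: extensions_def)
qed

lemma symmetric_row_weights: "symmetric_weights (row_weights s)"
  unfolding symmetric_weights_def row_weights_def using extensions_transpose finite_extensions by auto

lemma symmetric_column_weights: "symmetric_weights (column_weights k)"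
  unfolding symmetric_weights_def column_weights_def vertical_extensions_def
  using extensions_transpose finite_extensions by auto

lemma extensions_image:
  assumes "p \<in> partitions_upto n"
  shows "(\<lambda>\<alpha> i. p i + \<alpha> i) ` extensions n (\<lambda>_. 0) s = extensions n p s" (is ?row)
    and "(\<lambda>\<alpha> i. p i + \<alpha> i) ` vertical_extensions n (\<lambda>_. 0) s = vertical_extensions n p s" (is ?col)
proof -
  have p: "p i = 0" if "i \<ge> n" for i
    using assms part_length_le_iff[of p n] that by (auto simp: partitions_upto_def)
  have diff: "q = (\<lambda>i. p i + (q i - p i))" "(\<lambda>i. q i - p i) \<in> extensions n (\<lambda>_. 0) s"
    if "q \<in> extensions n p s" for q
  proof -
    have le: "\<And>i. p i \<le> q i" and sum: "sum q {..<n} = sum p {..<n} + s"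
      using that by (auto simp: extensions_def)
    have "(\<Sum>i<n. q i - p i) + sum p {..<n} = sum q {..<n}"
      using le by (simp flip: sum.distrib)
    then show "(\<lambda>i. q i - p i) \<in> extensions n (\<lambda>_. 0) s"
      using that sum by (auto simp: extensions_def)
    show "q = (\<lambda>i. p i + (q i - p i))" using le by (simp add: fun_eq_iff)
  qed
  have add: "(\<lambda>i. p i + \<alpha> i) \<in> extensions n p s" if "\<alpha> \<in> extensions n (\<lambda>_. 0) s" for \<alpha>
    using that p by (auto simp: extensions_def sum.distrib)
  show ?row using diff add by (auto intro!: image_eqI)
  show ?col
  proof (intro equalityI subsetI)
    fix q assume "q \<in> vertical_extensions n p s"
    then show "q \<in> (\<lambda>\<alpha> i. p i + \<alpha> i) ` vertical_extensions n (\<lambda>_. 0) s"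
      using diff[of q] by (intro image_eqI[of _ _ "\<lambda>i. q i - p i"])
        (auto simp: vertical_extensions_def le_diff_conv add.commute)
  qed (use add in \<open>auto simp: vertical_extensions_def\<close>)
qed

text \<open>Raising parts of a partition by at most one creates an ascent only of the form \<open>q\<^sub>j\<^sub>+\<^sub>1 = q\<^sub>j + 1\<close>, and then two
  adjacent exponents coincide. So every term that is not a partition vanishes by itself.\<close>

lemma column_pieri:
  assumes "p \<in> partitions_upto n"
  shows "weight_sum (column_weights k) \<otimes> schur p =
    (\<Oplus>q \<in> {q \<in> add_vertical p k. part_length q \<le> n}. schur q)"
proof -
  have p: "antimono p" using assms by (simp add: partitions_upto_def is_partition_def)
  have "schur q = \<zero>" if q: "q \<in> vertical_extensions n p k" "\<not> antimono q" for q
  proof -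
    obtain j where j: "q j < q (Suc j)" using q(2) antimono_SucI[of q] not_le by blast
    then have "q (Suc j) \<noteq> 0" by simp
    then have "Suc j < n"
      using q(1) by (cases "n \<le> Suc j") (auto simp: vertical_extensions_def extensions_def)
    \<comment> \<open>Since \<open>p\<close> is decreasing and \<open>q\<close> exceeds it by at most one, an ascent has height one.\<close>
    moreover have "q (Suc j) = q j + 1"
    proof -
      have "q (Suc j) \<le> p (Suc j) + 1" "p j \<le> q j"
        using q(1) by (auto simp: vertical_extensions_def extensions_def)
      moreover have "p (Suc j) \<le> p j" using antimonoD[OF p, of j "Suc j"] by simp
      ultimately show ?thesis using j by linarith
    qed
    ultimately show ?thesis by (rule schur_zero)
  qed
  then have "(\<Oplus>q \<in> vertical_extensions n p k. schur q)
      = (\<Oplus>q \<in> {q \<in> vertical_extensions n p k. antimono q}. schur q)"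
    using finite_extensions[of n p k]
    by (intro add.finprod_mono_neutral_cong_right) (auto simp: vertical_extensions_def)
  then show ?thesis
    using weight_sum_schur[OF symmetric_column_weights, of k p]
    unfolding column_weights_def extensions_image(2)[OF assms] add_vertical_extensions[OF assms]
    by simp
qed

text \<open>Terms outside the horizontal strips cancel in pairs. Such a \<open>q\<close> has an index \<open>i\<close> with \<open>q\<^sub>i\<^sub>+\<^sub>1 > p\<^sub>i\<close>; exchanging the
  adjacent exponents at the largest such index changes the sign, stays above \<open>p\<close>, and does not change which index
  is the largest, because the condition at \<open>i\<close> only sees \<open>q\<^sub>i\<^sub>+\<^sub>1\<close>.\<close>

lemma row_pieri:
  assumes "p \<in> partitions_upto n"
  shows "weight_sum (row_weights s) \<otimes> schur p =
    (\<Oplus>q \<in> {q \<in> add_horizontal p s. part_length q \<le> n}. schur q)"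
proof -
  have p: "antimono p" using assms by (simp add: partitions_upto_def is_partition_def)
  let ?E = "extensions n p s" and ?H = "horizontal_extensions n p s"
  define bad where "bad q = {i. p i < q (Suc i)}" for q
  define \<sigma> where "\<sigma> q = (let j = Max (bad q) in q(j := q (Suc j) - 1, Suc j := q j + 1))" for q :: "nat \<Rightarrow> nat"
  \<comment> \<open>The last conjunct makes \<open>\<sigma>\<close> an involution: both applications exchange at the same index.\<close>
  have main: "finite (bad q) \<and> Max (bad q) \<in> bad q \<and> Suc (Max (bad q)) < n \<and>
      \<sigma> q \<in> ?E - ?H \<and> Max (bad (\<sigma> q)) = Max (bad q)" if q: "q \<in> ?E - ?H" for q
  proof -
    have zero: "\<And>i. i \<ge> n \<Longrightarrow> q i = 0" and le: "\<And>i. p i \<le> q i"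
      and sum: "sum q {..<n} = sum p {..<n} + s"
      using q by (auto simp: extensions_def)
    have lt: "Suc i < n" if "i \<in> bad q" for i
      using that zero[of "Suc i"] by (cases "n \<le> Suc i") (auto simp: bad_def)
    have fin: "finite (bad q)"
      by (rule finite_subset[of _ "{..<n}"]) (use lt Suc_lessD in blast, simp)
    have ne: "bad q \<noteq> {}" using q by (auto simp: horizontal_extensions_def bad_def not_le)
    define j where "j = Max (bad q)"
    have j: "j \<in> bad q" unfolding j_def using fin ne by (rule Max_in)
    have jn: "Suc j < n" using lt[OF j] .
    have \<sigma>: "\<sigma> q = q(j := q (Suc j) - 1, Suc j := q j + 1)" by (simp add: \<sigma>_def j_def Let_def)
    have pj: "p j < q (Suc j)" "p (Suc j) \<le> p j" using j antimonoD[OF p, of j "Suc j"] by (auto simp: bad_def)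
    have "sum (\<sigma> q) {..<n} = sum q {..<n}"
    proof -
      have split: "{..<n} = insert j (insert (Suc j) ({..<n} - {j, Suc j}))" using jn by auto
      have "sum (\<sigma> q) ({..<n} - {j, Suc j}) = sum q ({..<n} - {j, Suc j})"
        by (rule sum.cong) (auto simp: \<sigma>)
      then show ?thesis
        by (subst (1 2) split) (use pj in \<open>simp add: \<sigma>\<close>)
    qed
    moreover have "p i \<le> \<sigma> q i" for i using le[of i] le[of j] pj by (auto simp: \<sigma>)
    moreover have "\<sigma> q i = 0" if "i \<ge> n" for i using that zero jn by (auto simp: \<sigma>)
    ultimately have E: "\<sigma> q \<in> ?E" using sum by (simp add: extensions_def)
    have jbad: "j \<in> bad (\<sigma> q)" using le[of j] by (simp add: bad_def \<sigma>)
    have "\<sigma> q \<notin> ?H" using jbad by (auto simp: horizontal_extensions_def bad_def not_le)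
    have upper: "i \<le> j" if "i \<in> bad (\<sigma> q)" for i
    proof (rule ccontr)
      assume "\<not> i \<le> j"
      then have "i \<in> bad q" using that by (auto simp: bad_def \<sigma>)
      then show False using \<open>\<not> i \<le> j\<close> fin unfolding j_def by simp
    qed
    have "finite (bad (\<sigma> q))" by (rule finite_subset[of _ "{..j}"]) (use upper in auto)
    then have "Max (bad (\<sigma> q)) = j" using upper jbad by (rule Max_eqI)
    then show ?thesis using fin j jn E \<open>\<sigma> q \<notin> ?H\<close> unfolding j_def by blast
  qed
  have "finsum R schur (?E - ?H) \<in> {\<zero>}"
  proof (rule finsum_involution_mem[where \<sigma> = \<sigma>])
    show "finite (?E - ?H)" using finite_extensions by blast
    fix q assume q: "q \<in> ?E - ?H"
    define j where "j = Max (bad q)"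
    have \<sigma>: "\<sigma> q = q(j := q (Suc j) - 1, Suc j := q j + 1)" by (simp add: \<sigma>_def j_def Let_def)
    have \<sigma>\<sigma>: "\<sigma> (\<sigma> q) = (\<sigma> q)(j := \<sigma> q (Suc j) - 1, Suc j := \<sigma> q j + 1)"
      using main[OF q] unfolding \<sigma>_def[of "\<sigma> q"] by (simp add: j_def Let_def)
    have j: "Suc j < n" "q (Suc j) \<noteq> 0" using main[OF q] by (auto simp: j_def bad_def)
    show "\<sigma> q \<in> ?E - ?H" using main[OF q] by blast
    show "\<sigma> (\<sigma> q) = q" unfolding \<sigma>\<sigma> unfolding \<sigma> using j by (auto simp: fun_eq_iff)
    show "schur q \<oplus> schur (\<sigma> q) \<in> {\<zero>}" unfolding \<sigma> using schur_swap j by simp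
    show "schur q \<in> {\<zero>}" if "\<sigma> q = q"
      using fun_cong[OF that, of "Suc j"] schur_zero[of j q] j by (simp add: \<sigma>)
  qed auto
  then have cancel: "finsum R schur (?E - ?H) = \<zero>" by simp
  have "finsum R schur ?E = finsum R schur (?H \<union> (?E - ?H))"
    by (rule arg_cong[of _ _ "finsum R schur"]) (auto simp: horizontal_extensions_def)
  also have "\<dots> = finsum R schur ?H \<oplus> finsum R schur (?E - ?H)"
    using finite_extensions[of n p s]
    by (intro finsum_Un_disjoint) (auto simp: horizontal_extensions_def)
  also have "\<dots> = finsum R schur ?H" by (simp add: cancel)
  finally show ?thesis
    using weight_sum_schur[OF symmetric_row_weights, of s p]
    unfolding row_weights_def extensions_image(1)[OF assms] add_horizontal_extensions[OF assms]
    by simp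
qed

text \<open>Once \<open>schur f = c \<cdot> schur 0\<close> with \<open>c\<close> central, the product contains the block \<open>P D P D P = P\<close>, where
  \<open>P = \<psi>\<^sub>w\<^sub>0\<close>, and collapses.\<close>

lemma schur_mult:
  fixes e f :: "nat \<Rightarrow> nat"
  defines "D \<equiv> y_mon (\<lambda>i. n - i)"
  assumes X: "symmetric_weights X" and f: "weight_sum X \<otimes> schur (\<lambda>_. 0) = schur f"
  shows "(schur e \<otimes> D) \<otimes> (schur f \<otimes> D) = weight_sum X \<otimes> schur e \<otimes> D"
proof -
  let ?P = "psi_word (stairs n)" and ?c = "weight_sum X" and ?e = "y_mon (\<lambda>i. e (i - 1) + (n - i))"
  have fin: "finite X" using X by (simp add: symmetric_weights_def)
  have cl: "D \<in> carrier R" "?P \<in> carrier R" "?c \<in> carrier R" "?e \<in> carrier R" by (simp_all add: D_def)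
  have cP: "?P \<otimes> ?c = ?c \<otimes> ?P" by (rule weight_sum_commutes_staircase[OF X])
  have cD: "D \<otimes> ?c = ?c \<otimes> D" unfolding D_def by (rule weight_sum_commutes_y_mon[OF fin, symmetric])
  have ce: "?e \<otimes> ?c = ?c \<otimes> ?e" by (rule weight_sum_commutes_y_mon[OF fin, symmetric])
  have schur: "schur e = ?P \<otimes> ?e \<otimes> ?P" "schur f = ?c \<otimes> (?P \<otimes> D \<otimes> ?P)"
    unfolding f[symmetric] by (simp_all add: schur_def sandwich_def D_def)
  have "schur e \<otimes> ?c = ?P \<otimes> ?e \<otimes> (?P \<otimes> ?c)" unfolding schur(1) using cl by (simp add: m_assoc)
  also have "\<dots> = ?P \<otimes> (?e \<otimes> ?c) \<otimes> ?P" unfolding cP using cl by (simp add: m_assoc)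
  also have "\<dots> = (?P \<otimes> ?c) \<otimes> ?e \<otimes> ?P" unfolding ce using cl by (simp add: m_assoc)
  also have "\<dots> = ?c \<otimes> schur e" unfolding cP schur(1) using cl by (simp add: m_assoc)
  finally have cs: "schur e \<otimes> ?c = ?c \<otimes> schur e" .
  have "(schur e \<otimes> D) \<otimes> (schur f \<otimes> D) = schur e \<otimes> (D \<otimes> ?c) \<otimes> (?P \<otimes> D \<otimes> ?P) \<otimes> D"
    unfolding schur(2) using cl by (simp add: m_assoc)
  also have "\<dots> = (schur e \<otimes> ?c) \<otimes> D \<otimes> (?P \<otimes> D \<otimes> ?P) \<otimes> D"
    unfolding cD using cl by (simp add: m_assoc)
  also have "\<dots> = ?c \<otimes> ?P \<otimes> ?e \<otimes> (?P \<otimes> D \<otimes> ?P \<otimes> D \<otimes> ?P) \<otimes> D"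
    unfolding cs unfolding schur(1) using cl by (simp add: m_assoc)
  also have "\<dots> = ?c \<otimes> schur e \<otimes> D"
    unfolding staircase_idempotent[folded D_def] schur(1) using cl by (simp add: m_assoc)
  finally show ?thesis .
qed

text \<open>The only partition obtained from the empty one by adding a vertical strip of size \<open>k\<close> is \<open>(1\<^sup>k)\<close>, so the
  Pieri rule itself identifies its element with \<open>e\<^sub>k\<close>; likewise \<open>(s)\<close> with \<open>h\<^sub>s\<close>.\<close>

lemma column_schur: "k \<le> n \<Longrightarrow> weight_sum (column_weights k) \<otimes> schur (\<lambda>_. 0) = schur (col_part k)"
  unfolding column_pieri[OF empty_partition] add_vertical_extensions[OF empty_partition]
  by (simp add: vertical_extensions_empty)

lemma row_schur: "n \<ge> 1 \<Longrightarrow> weight_sum (row_weights s) \<otimes> schur (\<lambda>_. 0) = schur (row_part s)"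
  unfolding row_pieri[OF empty_partition] add_horizontal_extensions[OF empty_partition]
  by (simp add: horizontal_extensions_empty)

end

section \<open>The nilHecke algebra by generators and relations\<close>

text \<open>A relation \<open>a = b\<close> is imposed by a generator \<open>a - b\<close> of the ideal, so \<open>a\<close> and \<open>b\<close> have the same coset, and
  passing to cosets is a ring homomorphism.\<close>

lemma nh_gen_relations:
  fixes n :: nat
  defines "H \<equiv> nilHecke n :: 'k::field nilHecke_elem ring"
  shows "nilHecke_relations H n (\<lambda>i. nh_gen n (Psi i)) (\<lambda>i. nh_gen n (Y i))"
proof -
  let ?F = "free_alg n :: (gen word \<Rightarrow>\<^sub>0 'k) ring"
  let ?I = "Idl\<^bsub>?F\<^esub> (nilHecke_rels n)"
  interpret F: ring ?F by (rule free_alg_ring)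
  interpret I: ideal ?I ?F by (rule F.genideal_ideal[OF nilHecke_rels_in_free_alg])
  define h where "h = (+>\<^bsub>?F\<^esub>) ?I"
  have hom: "h \<in> ring_hom ?F H"
    unfolding h_def H_def nilHecke_def by (rule I.rcos_ring_hom)
  have F_ops: "x \<otimes>\<^bsub>?F\<^esub> z = x * z" "x \<oplus>\<^bsub>?F\<^esub> z = x + z" "\<one>\<^bsub>?F\<^esub> = 1" "\<zero>\<^bsub>?F\<^esub> = 0" for x z
    by (simp_all add: free_alg_def)
  have h_mult: "h (a * b) = h a \<otimes>\<^bsub>H\<^esub> h b" and h_add: "h (a + b) = h a \<oplus>\<^bsub>H\<^esub> h b"
    if "a \<in> carrier ?F" "b \<in> carrier ?F" for a b
    using ring_hom_mult[OF hom that] ring_hom_add[OF hom that] by (simp_all add: F_ops)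
  have h_one: "h 1 = \<one>\<^bsub>H\<^esub>" using ring_hom_one[OF hom] by (simp add: F_ops)
  have h_eq: "h a = h b" if "a - b \<in> nilHecke_rels n" "a \<in> carrier ?F" "b \<in> carrier ?F" for a b
  proof -
    have "\<ominus>\<^bsub>?F\<^esub> b = - b"
      using F.minus_equality[of "- b" b] that(3) free_alg_uminus[of b n] by (simp add: F_ops)
    then have "a \<ominus>\<^bsub>?F\<^esub> b \<in> ?I"
      using F.genideal_self[OF nilHecke_rels_in_free_alg] that(1) by (auto simp: a_minus_def F_ops)
    then show ?thesis unfolding h_def
      using F.quotient_eq_iff_same_a_r_cos[OF I.is_ideal that(2,3)] by blast
  qed
  interpret H: ring H unfolding H_def by (rule nilHecke_ring)
  have h_zero: "h 0 = \<zero>\<^bsub>H\<^esub>" using hom F.ring_axioms H.ring_axioms ring_hom_zero[of h ?F H] by (simp add: F_ops)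
  have gen: "nh_gen n g = h (var g)" for g by (simp add: nh_gen_def h_def)
  have psi: "var (Psi r) \<in> carrier ?F" if "r \<in> {1..<n}" for r
    using that by (intro var_in_free_alg) (simp add: gens_def)
  have y: "var (Y r) \<in> carrier ?F" if "r \<in> {1..n}" for r
    using that by (intro var_in_free_alg) (simp add: gens_def)
  note closed = psi y free_alg_mult free_alg_add free_alg_one
  note h_simps = h_mult h_add h_one h_zero
  have closed_h: "h a \<in> carrier H" if "a \<in> carrier ?F" for a using ring_hom_closed[OF hom that] .
  show ?thesis
    unfolding gen
  proof (unfold_locales, goal_cases)
    case (1 r)
    then show ?case by (intro closed_h psi)
  next
    case (2 r)
    then show ?case by (intro closed_h y)
  next
    case (3 r)
    have "h (var (Psi r) * var (Psi r)) = h 0"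
      using 3 by (intro h_eq closed F.zero_closed[unfolded F_ops]) (auto simp: nilHecke_rels_def Let_def)
    then show ?case using 3 by (simp add: h_simps closed)
  next
    case (4 r k)
    have "h (var (Psi r) * var (Psi k)) = h (var (Psi k) * var (Psi r))"
      using 4 by (intro h_eq closed) ((unfold nilHecke_rels_def Let_def, blast) | simp)+
    then show ?case using 4 by (simp add: h_simps closed)
  next
    case (5 r)
    have "h (var (Psi r) * var (Psi (r + 1)) * var (Psi r)) = h (var (Psi (r + 1)) * var (Psi r) * var (Psi (r + 1)))"
      using 5 by (intro h_eq closed) ((unfold nilHecke_rels_def Let_def, blast) | simp)+
    then show ?case using 5 by (simp add: h_simps closed)
  next
    case (6 r k)
    have "h (var (Y r) * var (Y k)) = h (var (Y k) * var (Y r))"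
      using 6 by (intro h_eq closed) ((unfold nilHecke_rels_def Let_def, blast) | simp)+
    then show ?case using 6 by (simp add: h_simps closed)
  next
    case (7 r)
    have "h (var (Psi r) * var (Y (r + 1))) = h (var (Y r) * var (Psi r) + 1)"
      using 7 by (intro h_eq closed) ((unfold nilHecke_rels_def Let_def, blast) | simp)+
    then show ?case using 7 by (simp add: h_simps closed)
  next
    case (8 r)
    have "h (var (Y (r + 1)) * var (Psi r)) = h (var (Psi r) * var (Y r) + 1)"
      using 8 by (intro h_eq closed) ((unfold nilHecke_rels_def Let_def, blast) | simp)+
    then show ?case using 8 by (simp add: h_simps closed)
  next
    case (9 r k)
    have "h (var (Psi r) * var (Y k)) = h (var (Y k) * var (Psi r))"
      using 9 by (intro h_eq closed) ((unfold nilHecke_rels_def Let_def, blast) | simp)+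
    then show ?case using 9 by (simp add: h_simps closed)
  qed
qed

theorem proposition3p22:
  fixes n k s :: nat and p :: "nat \<Rightarrow> nat"
  assumes "n \<ge> 1" and "p \<in> partitions_upto n" and "k \<le> n"
  shows "(nh_b n p :: 'k::field nilHecke_elem) \<otimes>\<^bsub>nilHecke n\<^esub> nh_b n (col_part k)
           = (\<Oplus>\<^bsub>nilHecke n\<^esub>q \<in> add_vertical p k. nh_b n q)
       \<and> (nh_b n p :: 'k nilHecke_elem) \<otimes>\<^bsub>nilHecke n\<^esub> nh_b n (row_part s)
           = (\<Oplus>\<^bsub>nilHecke n\<^esub>q \<in> add_horizontal p s. nh_b n q)"
proof -
  let ?H = "nilHecke n :: 'k nilHecke_elem ring"
  let ?b = "nh_b n :: (nat \<Rightarrow> nat) \<Rightarrow> 'k nilHecke_elem"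
  interpret nilHecke_relations ?H n "\<lambda>i. nh_gen n (Psi i)" "\<lambda>i. nh_gen n (Y i)"
    by (rule nh_gen_relations)
  let ?D = "y_mon (\<lambda>i. n - i)"
  have "psi_perm n (longest_perm n) = psi_word (stairs n)"
  proof -
    define w where "w = (SOME w. reduced_expr n (longest_perm n) w)"
    have w: "reduced_expr n (longest_perm n) w"
      unfolding w_def by (rule someI[of _ "stairs n"]) (rule reduced_expr_stairs)
    then have "psi_word w = psi_word (stairs n)"
      using reduced_expr_longest by (intro psi_word_braid_equiv) (auto simp: reduced_expr_def)
    then show ?thesis by (simp add: psi_perm_def psi_word_def w_def)
  qed
  then have b: "?b q = schur q \<otimes>\<^bsub>?H\<^esub> ?D" if "part_length q \<le> n" for q
    using that by (simp add: nh_b_def schur_def sandwich_def y_monom_def y_mon_def y_prod_def)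
  have b0: "?b q = \<zero>\<^bsub>?H\<^esub>" if "\<not> part_length q \<le> n" for q using that by (simp add: nh_b_def)
  have b_closed: "?b q \<in> carrier ?H" for q by (cases "part_length q \<le> n") (simp_all add: b b0)
  have sum_b: "finsum ?H ?b A = finsum ?H schur {q \<in> A. part_length q \<le> n} \<otimes>\<^bsub>?H\<^esub> ?D"
    if "finite A" for A
  proof -
    have "finsum ?H ?b A = (\<Oplus>\<^bsub>?H\<^esub>q \<in> {q \<in> A. part_length q \<le> n}. schur q \<otimes>\<^bsub>?H\<^esub> ?D)"
      using that by (intro add.finprod_mono_neutral_cong_right) (auto simp: b b0 b_closed)
    also have "\<dots> = finsum ?H schur {q \<in> A. part_length q \<le> n} \<otimes>\<^bsub>?H\<^esub> ?D"
      using that by (intro finsum_ldistr[symmetric]) auto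
    finally show ?thesis .
  qed
  have p: "is_partition p" "part_length p \<le> n" using assms(2) by (auto simp: partitions_upto_def)
  have fin: "finite (add_vertical p k)" "finite (add_horizontal p s)"
    using finite_add_boxes[OF p(1)] by (simp_all add: add_vertical_def add_horizontal_def)
  have len: "part_length (col_part k) \<le> n" "part_length (row_part s) \<le> n"
    using assms(1,3) by (cases "s = 0"; simp add: part_length_def col_part_def row_part_def)+
  have "?b p \<otimes>\<^bsub>?H\<^esub> ?b (col_part k) = weight_sum (column_weights k) \<otimes>\<^bsub>?H\<^esub> schur p \<otimes>\<^bsub>?H\<^esub> ?D"
    unfolding b[OF p(2)] b[OF len(1)] by (rule schur_mult[OF symmetric_column_weights column_schur[OF assms(3)]])
  moreover have "?b p \<otimes>\<^bsub>?H\<^esub> ?b (row_part s) = weight_sum (row_weights s) \<otimes>\<^bsub>?H\<^esub> schur p \<otimes>\<^bsub>?H\<^esub> ?D"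
    unfolding b[OF p(2)] b[OF len(2)] by (rule schur_mult[OF symmetric_row_weights row_schur[OF assms(1)]])
  ultimately show ?thesis
    unfolding column_pieri[OF assms(2)] row_pieri[OF assms(2)] sum_b[OF fin(1)] sum_b[OF fin(2)] by blast
qed

end
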